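(* Let $\alpha \in (0,1)$. The optimal objective $\mathrm{las}_2(n)$ of the second level of the Lasserre hierarchy for bounding $N_\alpha(n)$ satisfies $$\mathrm{las}_2(n) \leq c_\alpha + \frac{1+\alpha}{2\alpha}\, n$$ for $n \geq n_\alpha$, where $c_\alpha$ does not depend on the dimension $n$. (That is, for every $\alpha\in(0,1)$ there exist a constant $c_\alpha$ and an integer $n_\alpha$, both depending only on $\alpha$, such that the inequality holds for all $n\ge n_\alpha$.)
   Context: $N_\alpha(n)$ denotes the maximum number of lines through the origin in $\mathbb{R}^n$ such that the angle between any pair of distinct lines is $\arccos\alpha$. Let $D = \{\alpha,-\alpha\}$, and let $G$ be the infinite graph with vertex set the unit sphere $S^{n-1}\subset\mathbb{R}^n$ in which two distinct vertices $x,y$ are adjacent if $x\cdot y\notin D$. An independent set is a subset of $S^{n-1}$ in which no two vertices are adjacent. So a finite set is independent if and only if any two distinct elements have inner product in $D$. For an integer $s\ge 0$, let $\mathcal{I}_s$ be the set of all independent sets of cardinality at most $s$ (including $\emptyset$). It is topologized as follows: $\emptyset$ is an isolated point, and $\mathcal{I}_s\setminus\{\emptyset\}$ carries the subspace topology from the set of nonempty subsets of $S^{n-1}$ of size at most $s$, which has the quotient topology under $(S^{n-1})^s\to\{\text{nonempty subsets of size}\le s\}$, $(x_1,\dots,x_s)\mapsto\{x_1,\dots,x_s\}$. Let $\mathcal{C}(X)$ be the space of real-valued continuous functions on $X$, and let $\mathcal{C}(\mathcal{I}_t\times\mathcal{I}_t)_{\succeq 0}$ be the cone of positive kernels, that is,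 of symmetric continuous functions $K\colon\mathcal{I}_t\times\mathcal{I}_t\to\mathbb{R}$ with $\sum_{i,j=1}^N c_ic_jK(J_i,J_j)\ge 0$ for all $N\ge 0$, $c\in\mathbb{R}^N$ and $J_1,\dots,J_N\in\mathcal{I}_t$. For a symmetric continuous function $K$ on $\mathcal{I}_t\times\mathcal{I}_t$ and $S\in\mathcal{I}_{2t}$, define $$A_tK(S)=\sum_{\substack{J,J'\in\mathcal{I}_t\\ J\cup J'=S}}K(J,J').$$ Let $1_{\mathcal{I}_{=1}}$ be the indicator function of the set of independent sets of size exactly $1$. The $t$-th level of the Lasserre hierarchy is the optimization problem: minimize $K(\emptyset,\emptyset)$ over all $K\in\mathcal{C}(\mathcal{I}_t\times\mathcal{I}_t)_{\succeq 0}$ satisfying $A_tK(S)\le -1_{\mathcal{I}_{=1}}(S)$ for all $S\in\mathcal{I}_{2t}\setminus\{\emptyset\}$. The number $\mathrm{las}_2(n)$ is the optimal objective value (infimum) of this problem for $t=2$. *)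

theory Defs
  imports "HOL-Analysis.Analysis"
begin

text \<open>
  The dimension \<open>n\<close> is quantified inside the main statement, so $\mathbb{R}^n$ is the library's
  \<^const>\<open>Euclidean_space\<close> \<open>n\<close>: sequences \<open>nat \<Rightarrow> real\<close> vanishing from index \<open>n\<close> on, with the
  topology of pointwise convergence.
\<close>

definition dot_prod :: "nat \<Rightarrow> (nat \<Rightarrow> real) \<Rightarrow> (nat \<Rightarrow> real) \<Rightarrow> real" where
  "dot_prod n x y = (\<Sum>i<n. x i * y i)"

definition unit_sphere :: "nat \<Rightarrow> (nat \<Rightarrow> real) topology" where
  "unit_sphere n = subtopology (Euclidean_space n) {x. dot_prod n x x = 1}"

definition adjacent :: "real \<Rightarrow> nat \<Rightarrow> (nat \<Rightarrow> real) \<Rightarrow> (nat \<Rightarrow> real) \<Rightarrow> bool" where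
  "adjacent \<alpha> n x y \<longleftrightarrow> x \<noteq> y \<and> dot_prod n x y \<notin> {\<alpha>, - \<alpha>}"

definition independent_set :: "real \<Rightarrow> nat \<Rightarrow> (nat \<Rightarrow> real) set \<Rightarrow> bool" where
  "independent_set \<alpha> n S \<longleftrightarrow>
     S \<subseteq> topspace (unit_sphere n) \<and> (\<forall>x\<in>S. \<forall>y\<in>S. \<not> adjacent \<alpha> n x y)"

definition indep_sets :: "real \<Rightarrow> nat \<Rightarrow> nat \<Rightarrow> (nat \<Rightarrow> real) set set" where
  "indep_sets \<alpha> n s = {S. independent_set \<alpha> n S \<and> finite S \<and> card S \<le> s}"

definition indep_singletons :: "real \<Rightarrow> nat \<Rightarrow> (nat \<Rightarrow> real) set set" where
  "indep_singletons \<alpha> n = {S. independent_set \<alpha> n S \<and> card S = 1}"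

definition nonempty_subsets_le :: "'a topology \<Rightarrow> nat \<Rightarrow> 'a set set" where
  "nonempty_subsets_le X s = {A. A \<subseteq> topspace X \<and> A \<noteq> {} \<and> finite A \<and> card A \<le> s}"

text \<open>
  The quotient topology under $(x_1,\dots,x_s) \mapsto \{x_1,\dots,x_s\}$; a tuple is an
  extensional function on \<open>{..<s}\<close>, and the map takes its range.
\<close>

definition subsets_topology :: "'a topology \<Rightarrow> nat \<Rightarrow> 'a set topology" where
  "subsets_topology X s = topology (\<lambda>U. U \<subseteq> nonempty_subsets_le X s \<and>
     openin (product_topology (\<lambda>_. X) {..<s})
       {x \<in> topspace (product_topology (\<lambda>_. X) {..<s}). x ` {..<s} \<in> U})"

lemma openin_subsets_topology:
  "openin (subsets_topology X s) U \<longleftrightarrow> U \<subseteq> nonempty_subsets_le X s \<and>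
     openin (product_topology (\<lambda>_. X) {..<s})
       {x \<in> topspace (product_topology (\<lambda>_. X) {..<s}). x ` {..<s} \<in> U}"
proof -
  let ?P = "product_topology (\<lambda>_. X) {..<s}"
  let ?pre = "\<lambda>U. {x \<in> topspace ?P. x ` {..<s} \<in> U}"
  have "istopology (\<lambda>U. U \<subseteq> nonempty_subsets_le X s \<and> openin ?P (?pre U))"
    unfolding istopology_def
  proof (intro conjI allI impI)
    fix S T
    assume "S \<subseteq> nonempty_subsets_le X s \<and> openin ?P (?pre S)"
      and "T \<subseteq> nonempty_subsets_le X s \<and> openin ?P (?pre T)"
    moreover have "?pre (S \<inter> T) = ?pre S \<inter> ?pre T" by auto
    ultimately show "S \<inter> T \<subseteq> nonempty_subsets_le X s" "openin ?P (?pre (S \<inter> T))"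
      by (auto intro: openin_Int)
  next
    fix \<K>
    assume *: "\<forall>K\<in>\<K>. K \<subseteq> nonempty_subsets_le X s \<and> openin ?P (?pre K)"
    then show "\<Union>\<K> \<subseteq> nonempty_subsets_le X s" by blast
    have "?pre (\<Union>\<K>) = \<Union>(?pre ` \<K>)" by auto
    moreover have "openin ?P (\<Union>(?pre ` \<K>))"
      using * by (intro openin_Union) blast
    ultimately show "openin ?P (?pre (\<Union>\<K>))" by simp
  qed
  then show ?thesis
    by (simp add: subsets_topology_def topology_inverse')
qed

lemma image_in_nonempty_subsets_le:
  assumes "x \<in> topspace (product_topology (\<lambda>_. X) {..<s})" "s \<ge> 1"
  shows "x ` {..<s} \<in> nonempty_subsets_le X s"
  using assms card_image_le[of "{..<s}" x]
  by (auto simp: nonempty_subsets_le_def PiE_iff lessThan_empty_iff)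

lemma topspace_subsets_topology [simp]:
  "topspace (subsets_topology X s) = nonempty_subsets_le X s"
proof -
  let ?P = "product_topology (\<lambda>_. X) {..<s}"
  have "openin ?P {x \<in> topspace ?P. x ` {..<s} \<in> nonempty_subsets_le X s}"
  proof (cases "s = 0")
    case True
    then have "{x \<in> topspace ?P. x ` {..<s} \<in> nonempty_subsets_le X s} = {}"
      by (auto simp: nonempty_subsets_le_def)
    then show ?thesis by (simp only: openin_empty)
  next
    case False
    then have "{x \<in> topspace ?P. x ` {..<s} \<in> nonempty_subsets_le X s} = topspace ?P"
      using image_in_nonempty_subsets_le[of _ X s] by auto
    then show ?thesis by (simp only: openin_topspace)
  qed
  then have "openin (subsets_topology X s) (nonempty_subsets_le X s)"
    by (simp add: openin_subsets_topology)
  then show ?thesis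
    by (meson openin_subset openin_subsets_topology openin_topspace subset_antisym)
qed

lemma quotient_map_subsets_topology:
  assumes "s \<ge> 1"
  shows "quotient_map (product_topology (\<lambda>_. X) {..<s}) (subsets_topology X s) (\<lambda>x. x ` {..<s})"
  unfolding quotient_map_def
proof (intro conjI allI impI)
  let ?P = "product_topology (\<lambda>_. X) {..<s}"
  show "(\<lambda>x. x ` {..<s}) ` topspace ?P = topspace (subsets_topology X s)"
  proof (intro subset_antisym subsetI)
    fix A assume "A \<in> (\<lambda>x. x ` {..<s}) ` topspace ?P"
    then show "A \<in> topspace (subsets_topology X s)"
      using image_in_nonempty_subsets_le[OF _ assms] by auto
  next
    fix A assume "A \<in> topspace (subsets_topology X s)"
    then have A: "A \<subseteq> topspace X" "A \<noteq> {}" "finite A" "card A \<le> s"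
      by (auto simp: nonempty_subsets_le_def)
    obtain h where h: "bij_betw h {..<card A} A"
      using A(3) ex_bij_betw_nat_finite[of A] by (auto simp: atLeast0LessThan)
    obtain a where a: "a \<in> A" using A(2) by blast
    define x where "x = restrict (\<lambda>i. if i < card A then h i else a) {..<s}"
    have "x ` {..<s} = A"
    proof
      show "x ` {..<s} \<subseteq> A" using h a by (auto simp: x_def bij_betw_def)
      show "A \<subseteq> x ` {..<s}"
      proof
        fix y assume "y \<in> A"
        then obtain i where "i < card A" "y = h i" using h by (auto simp: bij_betw_def)
        then show "y \<in> x ` {..<s}" using A(4) by (auto simp: x_def intro!: image_eqI[of _ _ i])
      qed
    qed
    moreover have "x \<in> topspace ?P"
      using \<open>x ` {..<s} = A\<close> A(1) by (auto simp: PiE_iff x_def)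
    ultimately show "A \<in> (\<lambda>x. x ` {..<s}) ` topspace ?P" by blast
  qed
qed (simp add: openin_subsets_topology)

text \<open>The empty set is isolated; the rest carries the subspace topology.\<close>

definition indep_topology :: "real \<Rightarrow> nat \<Rightarrow> nat \<Rightarrow> (nat \<Rightarrow> real) set topology" where
  "indep_topology \<alpha> n s = topology (\<lambda>U. U \<subseteq> indep_sets \<alpha> n s \<and>
     openin (subtopology (subsets_topology (unit_sphere n) s) (indep_sets \<alpha> n s - {{}})) (U - {{}}))"

lemma openin_indep_topology:
  "openin (indep_topology \<alpha> n s) U \<longleftrightarrow> U \<subseteq> indep_sets \<alpha> n s \<and>
     openin (subtopology (subsets_topology (unit_sphere n) s) (indep_sets \<alpha> n s - {{}})) (U - {{}})"
proof -
  let ?Y = "subtopology (subsets_topology (unit_sphere n) s) (indep_sets \<alpha> n s - {{}})"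
  have "istopology (\<lambda>U. U \<subseteq> indep_sets \<alpha> n s \<and> openin ?Y (U - {{}}))"
    unfolding istopology_def
  proof (intro conjI allI impI)
    fix S T
    assume "S \<subseteq> indep_sets \<alpha> n s \<and> openin ?Y (S - {{}})"
      and "T \<subseteq> indep_sets \<alpha> n s \<and> openin ?Y (T - {{}})"
    moreover have "S \<inter> T - {{}} = (S - {{}}) \<inter> (T - {{}})" by blast
    ultimately show "S \<inter> T \<subseteq> indep_sets \<alpha> n s" "openin ?Y (S \<inter> T - {{}})"
      by (auto intro: openin_Int)
  next
    fix \<K>
    assume *: "\<forall>K\<in>\<K>. K \<subseteq> indep_sets \<alpha> n s \<and> openin ?Y (K - {{}})"
    then show "\<Union>\<K> \<subseteq> indep_sets \<alpha> n s" by blast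
    have "\<Union>\<K> - {{}} = \<Union>((\<lambda>K. K - {{}}) ` \<K>)" by blast
    moreover have "openin ?Y (\<Union>((\<lambda>K. K - {{}}) ` \<K>))"
      using * by (intro openin_Union) blast
    ultimately show "openin ?Y (\<Union>\<K> - {{}})" by simp
  qed
  then show ?thesis
    by (simp add: indep_topology_def topology_inverse')
qed

lemma topspace_indep_topology [simp]: "topspace (indep_topology \<alpha> n s) = indep_sets \<alpha> n s"
proof -
  let ?Y = "subtopology (subsets_topology (unit_sphere n) s) (indep_sets \<alpha> n s - {{}})"
  have "indep_sets \<alpha> n s - {{}} \<subseteq> nonempty_subsets_le (unit_sphere n) s"
    by (auto simp: indep_sets_def independent_set_def nonempty_subsets_le_def)
  then have "topspace ?Y = indep_sets \<alpha> n s - {{}}"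
    by (auto simp: topspace_subtopology)
  then have "openin ?Y (indep_sets \<alpha> n s - {{}})"
    by (metis openin_topspace)
  then have "openin (indep_topology \<alpha> n s) (indep_sets \<alpha> n s)"
    by (simp add: openin_indep_topology)
  then show ?thesis
    by (meson openin_subset openin_indep_topology openin_topspace subset_antisym)
qed

text \<open>
  Kernels are total HOL functions; only their values on \<^term>\<open>indep_sets \<alpha> n t\<close> matter.
\<close>

definition positive_kernel ::
  "real \<Rightarrow> nat \<Rightarrow> nat \<Rightarrow> ((nat \<Rightarrow> real) set \<Rightarrow> (nat \<Rightarrow> real) set \<Rightarrow> real) \<Rightarrow> bool" where
  "positive_kernel \<alpha> n t K \<longleftrightarrow>
     continuous_map (prod_topology (indep_topology \<alpha> n t) (indep_topology \<alpha> n t))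
       euclideanreal (\<lambda>(J, J'). K J J') \<and>
     (\<forall>J\<in>indep_sets \<alpha> n t. \<forall>J'\<in>indep_sets \<alpha> n t. K J J' = K J' J) \<and>
     (\<forall>(N::nat) (c::nat \<Rightarrow> real) (J::nat \<Rightarrow> (nat \<Rightarrow> real) set).
        (\<forall>i<N. J i \<in> indep_sets \<alpha> n t) \<longrightarrow>
        (\<Sum>i<N. \<Sum>j<N. c i * c j * K (J i) (J j)) \<ge> 0)"

definition A_op ::
  "real \<Rightarrow> nat \<Rightarrow> nat \<Rightarrow> ((nat \<Rightarrow> real) set \<Rightarrow> (nat \<Rightarrow> real) set \<Rightarrow> real) \<Rightarrow>
     (nat \<Rightarrow> real) set \<Rightarrow> real" where
  "A_op \<alpha> n t K S =
     (\<Sum>(J, J')\<in>{(J, J'). J \<in> indep_sets \<alpha> n t \<and> J' \<in> indep_sets \<alpha> n t \<and> J \<union> J' = S}. K J J')"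

lemma finite_A_op_index:
  assumes "finite S"
  shows "finite {(J, J'). J \<in> indep_sets \<alpha> n t \<and> J' \<in> indep_sets \<alpha> n t \<and> J \<union> J' = S}"
  by (rule finite_subset[of _ "Pow S \<times> Pow S"]) (use assms in auto)

definition las_feasible ::
  "real \<Rightarrow> nat \<Rightarrow> nat \<Rightarrow> ((nat \<Rightarrow> real) set \<Rightarrow> (nat \<Rightarrow> real) set \<Rightarrow> real) set" where
  "las_feasible \<alpha> t n =
     {K. positive_kernel \<alpha> n t K \<and>
         (\<forall>S\<in>indep_sets \<alpha> n (2 * t) - {{}}. A_op \<alpha> n t K S \<le> - indicator (indep_singletons \<alpha> n) S)}"

text \<open>
  Extended reals, so that the optimal value is \<open>\<infinity>\<close> when there is no feasible kernel.
\<close>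

definition las :: "real \<Rightarrow> nat \<Rightarrow> nat \<Rightarrow> ereal" where
  "las \<alpha> t n = (INF K\<in>las_feasible \<alpha> t n. ereal (K {} {}))"

end

theory Submission
  imports Defs
begin

text \<open>
  The optimum is an infimum, so one feasible kernel in each dimension proves the bound. For a kernel
  \<open>K\<close> and an independent set \<open>C\<close> of \<open>N\<close> points the sum of \<open>K J J'\<close> over all \<open>J, J' \<subseteq> C\<close> of size at
  most two equals \<open>K {} {}\<close> plus the sum of \<open>A_op\<close> over the nonempty subsets of \<open>C\<close> of size at most
  four. The kernel below is built so that, with \<open>M = (1 + \<alpha>) / (2 \<alpha>) n + 1\<close>, this total is \<open>M - N\<close> to
  leading order. It is a sum of three Gram kernels.

  The hook kernel attaches to a pair the trace-free part of the tensor
  \<open>(x \<bullet> y) (x \<otimes> x - y \<otimes> y) \<otimes> (x \<and> y)\<close>. On disjoint pairs the first factors are orthogonal, since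
  all inner products have the same square; what remains is the removed trace, which has size \<open>1 / n\<close>
  and, for a typical four-point set, negative sign (lemma \<open>inner_disjoint_pairs\<close>). Pairs that share a
  point contribute \<open>\<alpha> (1 - \<alpha>) (1 - \<alpha>\<^sup>2)\<close> when the product of the three signs of the triangle is
  positive, and a negative amount otherwise (lemma \<open>inner_shared_point\<close>). With suitable
  weight, and \<open>\<nu> = N / M\<close>, this kernel contributes about \<open>M (\<nu>\<^sup>3 - \<nu>\<^sup>4)\<close>. The ratio of the two
  coefficients is where the slope \<open>(1 + \<alpha>) / (2 \<alpha>)\<close> comes from.

  The cardinality kernel depends only on the sizes of the two sets and contributes
  \<open>M (1 - \<nu>)\<^sup>2 (1 + \<nu> + \<nu>\<^sup>2) = M (1 - \<nu> - \<nu>\<^sup>3 + \<nu>\<^sup>4)\<close>, so that the sum is \<open>M (1 - \<nu>) = M - N\<close>.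

  Four-point sets with exactly two negative triangles can spoil the sign of the trace term. They are
  repaired by the quartic kernel, the Gram kernel of the symmetric tensors \<open>(x\<^sup>2 - y\<^sup>2)\<^sup>2\<close>, which
  vanishes on disjoint pairs joined by a positive four-cycle and is negative if the four-cycle is
  negative (lemma \<open>pairing_value_sum\<close> combines the two effects). Its weight is of order \<open>1 / M^3\<close>,
  too small to change the leading order elsewhere.

  All errors are smaller by a factor \<open>1 / M\<close> than the leading terms; adding two more squares to
  the cardinality kernel absorbs them at the cost of a constant independent of \<open>n\<close>.
\<close>

section \<open>Positive kernels and continuous features\<close>

lemma positive_kernel_feature:
  assumes "continuous_map (indep_topology \<alpha> n t) euclideanreal f"
  shows "positive_kernel \<alpha> n t (\<lambda>J J'. f J * f J')"
proof -
  let ?X = "indep_topology \<alpha> n t"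
  have "continuous_map (prod_topology ?X ?X) euclideanreal (\<lambda>p. (f \<circ> fst) p * (f \<circ> snd) p)"
    by (intro continuous_map_real_mult continuous_map_compose[OF _ assms] continuous_map_fst
        continuous_map_snd)
  moreover have "(\<lambda>p. (f \<circ> fst) p * (f \<circ> snd) p) = (\<lambda>(J, J'). f J * f J')"
    by auto
  moreover have "(\<Sum>i<N. \<Sum>j<N. c i * c j * (f (J i) * f (J j))) \<ge> 0"
    for N :: nat and c J
  proof -
    have "(\<Sum>i<N. \<Sum>j<N. c i * c j * (f (J i) * f (J j))) = (\<Sum>i<N. c i * f (J i))\<^sup>2"
      by (simp add: power2_eq_square sum_product algebra_simps)
    then show ?thesis by simp
  qed
  ultimately show ?thesis
    by (simp add: positive_kernel_def mult.commute)
qed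

lemma positive_kernel_zero: "positive_kernel \<alpha> n t (\<lambda>J J'. 0)"
  using positive_kernel_feature[of \<alpha> n t "\<lambda>_. 0"] by simp

lemma positive_kernel_add:
  assumes "positive_kernel \<alpha> n t K" "positive_kernel \<alpha> n t L"
  shows "positive_kernel \<alpha> n t (\<lambda>J J'. K J J' + L J J')"
proof -
  let ?X = "prod_topology (indep_topology \<alpha> n t) (indep_topology \<alpha> n t)"
  have "continuous_map ?X euclideanreal (\<lambda>p. (\<lambda>(J, J'). K J J') p + (\<lambda>(J, J'). L J J') p)"
    using assms by (intro continuous_map_add) (auto simp: positive_kernel_def)
  moreover have "(\<lambda>p. (\<lambda>(J, J'). K J J') p + (\<lambda>(J, J'). L J J') p) = (\<lambda>(J, J'). K J J' + L J J')"
    by auto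
  ultimately show ?thesis
    using assms by (simp add: positive_kernel_def distrib_left sum.distrib)
qed

lemma positive_kernel_scale:
  assumes "positive_kernel \<alpha> n t K" "b \<ge> 0"
  shows "positive_kernel \<alpha> n t (\<lambda>J J'. b * K J J')"
proof -
  let ?X = "prod_topology (indep_topology \<alpha> n t) (indep_topology \<alpha> n t)"
  have "continuous_map ?X euclideanreal (\<lambda>p. b * (\<lambda>(J, J'). K J J') p)"
    using assms by (intro continuous_map_real_mult_left) (auto simp: positive_kernel_def)
  moreover have "(\<lambda>p. b * (\<lambda>(J, J'). K J J') p) = (\<lambda>(J, J'). b * K J J')"
    by auto
  moreover have "(\<Sum>i<N. \<Sum>j<N. c i * c j * (b * K (J i) (J j)))
      = b * (\<Sum>i<N. \<Sum>j<N. c i * c j * K (J i) (J j))" for N :: nat and c J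
    by (simp add: sum_distrib_left algebra_simps)
  ultimately show ?thesis
    using assms by (simp add: positive_kernel_def)
qed

lemma positive_kernel_sum:
  assumes "\<And>i. i \<in> I \<Longrightarrow> positive_kernel \<alpha> n t (K i)"
  shows "positive_kernel \<alpha> n t (\<lambda>J J'. \<Sum>i\<in>I. K i J J')"
  using assms
proof (induction I rule: infinite_finite_induct)
  case (insert x F)
  then show ?case by (simp add: positive_kernel_add)
qed (simp_all add: positive_kernel_zero)

text \<open>
  Both orders of a pair are counted, hence the factor one half: for symmetric \<open>g\<close> vanishing on
  the diagonal the value at \<open>{x, y}\<close> is \<open>g x y\<close>, and the value at singletons is zero.
\<close>

definition pair_sum :: "('a \<Rightarrow> 'a \<Rightarrow> real) \<Rightarrow> 'a set \<Rightarrow> real" where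
  "pair_sum g J = (\<Sum>x\<in>J. \<Sum>y\<in>J. g x y) / 2"

lemma pair_sum_empty [simp]: "pair_sum g {} = 0"
  by (simp add: pair_sum_def)

lemma pair_sum_doubleton:
  assumes "g x x = 0" "g y y = 0" "g y x = g x y"
  shows "pair_sum g {x, y} = g x y"
  using assms by (cases "x = y") (auto simp: pair_sum_def)

abbreviation sphere_pairs :: "nat \<Rightarrow> (nat \<Rightarrow> nat \<Rightarrow> real) topology" where
  "sphere_pairs n \<equiv> product_topology (\<lambda>_. unit_sphere n) {..<2::nat}"

text \<open>
  Along the quotient map \<open>(x, y) \<mapsto> {x, y}\<close> such a feature pulls back to \<open>d + g x y\<close>; the vanishing of
  \<open>g\<close> on the diagonal is what makes this formula correct also where the two points collide. The
  value \<open>c\<close> at the empty set is free because the empty set is isolated.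
\<close>

lemma continuous_map_pair_feature:
  assumes sym: "\<And>x y. g x y = g y x"
    and diag: "\<And>x. x \<in> topspace (unit_sphere n) \<Longrightarrow> g x x = 0"
    and cont: "continuous_map (sphere_pairs n) euclideanreal (\<lambda>z. g (z 0) (z 1))"
  shows "continuous_map (indep_topology \<alpha> n 2) euclideanreal
           (\<lambda>J. if J = {} then c else d + pair_sum g J)" (is "continuous_map _ _ ?f")
proof -
  let ?Q = "subsets_topology (unit_sphere n) 2"
  have eq: "d + g (z 0) (z 1) = (?f \<circ> (\<lambda>z. z ` {..<2::nat})) z" if "z \<in> topspace (sphere_pairs n)" for z
  proof -
    have "z ` {..<2} = {z 0, z 1}" by (auto simp: numeral_2_eq_2 lessThan_Suc)
    moreover have "z 0 \<in> topspace (unit_sphere n)" "z 1 \<in> topspace (unit_sphere n)"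
      using that by (auto simp: PiE_iff)
    ultimately show ?thesis
      using pair_sum_doubleton[of g "z 0" "z 1"] diag sym by simp
  qed
  have "continuous_map (sphere_pairs n) euclideanreal (?f \<circ> (\<lambda>z. z ` {..<2::nat}))"
    by (rule continuous_map_eq[OF _ eq]) (intro continuous_map_add cont continuous_map_const[THEN iffD2], auto)
  then have Q: "continuous_map ?Q euclideanreal ?f"
    using continuous_compose_quotient_map[OF quotient_map_subsets_topology[of 2 "unit_sphere n"]] by simp
  let ?Y = "subtopology ?Q (indep_sets \<alpha> n 2 - {{}})"
  have Y: "continuous_map ?Y euclideanreal ?f"
    using Q by (rule continuous_map_from_subtopology)
  have top: "topspace ?Y = indep_sets \<alpha> n 2 - {{}}"
    by (auto simp: topspace_subtopology indep_sets_def independent_set_def nonempty_subsets_le_def)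
  show ?thesis
    unfolding continuous_map topspace_indep_topology
  proof (intro conjI allI impI)
    fix U assume "openin euclideanreal U"
    then have "openin ?Y {x \<in> topspace ?Y. ?f x \<in> U}"
      by (rule openin_continuous_map_preimage[OF Y])
    moreover have "{x \<in> topspace ?Y. ?f x \<in> U} = {J \<in> indep_sets \<alpha> n 2. ?f J \<in> U} - {{}}"
      unfolding top by blast
    ultimately show "openin (indep_topology \<alpha> n 2) {J \<in> indep_sets \<alpha> n 2. ?f J \<in> U}"
      unfolding openin_indep_topology by auto
  qed simp
qed

lemma continuous_map_unit_sphere_coord:
  assumes "continuous_map X (unit_sphere n) f"
  shows "continuous_map X euclideanreal (\<lambda>z. f z i)"
proof -
  have "continuous_map (unit_sphere n) euclideanreal (\<lambda>x. x i)"
    unfolding unit_sphere_def Euclidean_space_def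
    by (intro continuous_map_from_subtopology continuous_map_product_projection) auto
  from continuous_map_compose[OF assms this] show ?thesis by (simp add: o_def)
qed

lemma continuous_map_sphere_pairs_coord:
  assumes "k < 2"
  shows "continuous_map (sphere_pairs n) euclideanreal (\<lambda>z. z k i)"
  by (intro continuous_map_unit_sphere_coord[of _ n] continuous_map_product_projection) (use assms in auto)

lemma continuous_map_sphere_pairs_dot:
  assumes "k < 2" "l < 2"
  shows "continuous_map (sphere_pairs n) euclideanreal (\<lambda>z. dot_prod n (z k) (z l))"
  unfolding dot_prod_def
  by (intro continuous_map_sum continuous_map_real_mult continuous_map_sphere_pairs_coord assms) auto

lemma dot_prod_commute: "dot_prod n x y = dot_prod n y x"
  by (simp add: dot_prod_def mult.commute)

lemma dot_unit: "x \<in> topspace (unit_sphere n) \<Longrightarrow> dot_prod n x x = 1"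
  by (simp add: unit_sphere_def)

lemma indep_dot:
  assumes "independent_set \<alpha> n S" "x \<in> S" "y \<in> S" "x \<noteq> y"
  shows "dot_prod n x y = \<alpha> \<or> dot_prod n x y = - \<alpha>"
  using assms by (auto simp: independent_set_def adjacent_def)

lemma indep_unit: "independent_set \<alpha> n S \<Longrightarrow> x \<in> S \<Longrightarrow> dot_prod n x x = 1"
  using dot_unit by (auto simp: independent_set_def)

lemma card_le_two_cases:
  assumes "finite J" "card J \<le> 2"
  obtains "J = {}" | x where "J = {x}" | x y where "J = {x, y}" "x \<noteq> y"
proof -
  consider "card J = 0" | "card J = 1" | "card J = 2" using assms(2) by linarith
  then show ?thesis
    by cases (use assms that in \<open>auto simp: card_1_singleton_iff card_2_iff\<close>)
qed

text \<open>
  Cardinality is continuous on independent sets: distinct points have inner product \<open>\<plusminus>\<alpha>\<close>, so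
  \<open>(1 - (x \<bullet> y)\<^sup>2) / (1 - \<alpha>\<^sup>2)\<close> is 1 on two-point sets and 0 on singletons, and this expression is
  polynomial in the coordinates.
\<close>

lemma continuous_map_card_feature:
  assumes "\<alpha>\<^sup>2 \<noteq> 1"
  shows "continuous_map (indep_topology \<alpha> n 2) euclideanreal (\<lambda>J. w (card J))"
proof (rule continuous_map_eq)
  let ?g = "\<lambda>x y. (w 2 - w 1) * (1 - (dot_prod n x y)\<^sup>2) / (1 - \<alpha>\<^sup>2)"
  show "continuous_map (indep_topology \<alpha> n 2) euclideanreal
      (\<lambda>J. if J = {} then w 0 else w 1 + pair_sum ?g J)"
  proof (rule continuous_map_pair_feature)
    show "?g x y = ?g y x" for x y by (simp add: dot_prod_commute)
    show "?g x x = 0" if "x \<in> topspace (unit_sphere n)" for x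
      using dot_unit[OF that] by simp
    show "continuous_map (sphere_pairs n) euclideanreal (\<lambda>z. ?g (z 0) (z 1))"
      by (intro continuous_map_real_divide continuous_map_real_mult continuous_map_diff
          continuous_map_real_pow continuous_map_sphere_pairs_dot continuous_map_const[THEN iffD2])
        (use assms in auto)
  qed
  fix J assume "J \<in> topspace (indep_topology \<alpha> n 2)"
  then have J: "independent_set \<alpha> n J" "finite J" "card J \<le> 2" by (auto simp: indep_sets_def)
  show "(if J = {} then w 0 else w 1 + pair_sum ?g J) = w (card J)"
    using J(2,3)
  proof (cases rule: card_le_two_cases)
    case (2 x)
    then show ?thesis using indep_unit[OF J(1)] by (simp add: pair_sum_def)
  next
    case (3 x y)
    have "(dot_prod n x y)\<^sup>2 = \<alpha>\<^sup>2" using indep_dot[OF J(1), of x y] 3 by auto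
    then have "pair_sum ?g {x, y} = w 2 - w 1"
      using 3 assms indep_unit[OF J(1)]
      by (subst pair_sum_doubleton) (auto simp: dot_prod_commute)
    then have "pair_sum ?g J = w 2 - w 1" using 3 by simp
    moreover have "card J = 2" "J \<noteq> {}" using 3 by auto
    ultimately show ?thesis by simp
  qed simp
qed


section \<open>Tensors of rank four and their traces\<close>

type_synonym tensor = "nat \<Rightarrow> nat \<Rightarrow> nat \<Rightarrow> nat \<Rightarrow> real"

definition tensor_inner :: "nat \<Rightarrow> tensor \<Rightarrow> tensor \<Rightarrow> real" where
  "tensor_inner n F G = (\<Sum>i<n. \<Sum>j<n. \<Sum>k<n. \<Sum>l<n. F i j k l * G i j k l)"

lemma tensor_inner_commute: "tensor_inner n F G = tensor_inner n G F"
  by (simp add: tensor_inner_def mult.commute)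

lemma tensor_inner_diff_right:
  "tensor_inner n F (\<lambda>i j k l. G i j k l - H i j k l) = tensor_inner n F G - tensor_inner n F H"
  by (simp add: tensor_inner_def right_diff_distrib sum_subtractf)

lemma tensor_inner_add_right:
  "tensor_inner n F (\<lambda>i j k l. G i j k l + H i j k l) = tensor_inner n F G + tensor_inner n F H"
  by (simp add: tensor_inner_def distrib_left sum.distrib)

lemma tensor_inner_scale_right:
  "tensor_inner n F (\<lambda>i j k l. c * G i j k l) = c * tensor_inner n F G"
  by (simp add: tensor_inner_def sum_distrib_left mult.left_commute)

lemma tensor_inner_diff_left:
  "tensor_inner n (\<lambda>i j k l. G i j k l - H i j k l) F = tensor_inner n G F - tensor_inner n H F"
  by (simp add: tensor_inner_def left_diff_distrib sum_subtractf)

lemma tensor_inner_add_left: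
  "tensor_inner n (\<lambda>i j k l. G i j k l + H i j k l) F = tensor_inner n G F + tensor_inner n H F"
  by (simp add: tensor_inner_def distrib_right sum.distrib)

lemma tensor_inner_scale_left:
  "tensor_inner n (\<lambda>i j k l. c * G i j k l) F = c * tensor_inner n G F"
  by (simp add: tensor_inner_def sum_distrib_left mult.assoc)

lemmas tensor_inner_linear = tensor_inner_diff_right tensor_inner_add_right tensor_inner_scale_right
  tensor_inner_diff_left tensor_inner_add_left tensor_inner_scale_left

definition contraction :: "nat \<Rightarrow> tensor \<Rightarrow> nat \<Rightarrow> nat \<Rightarrow> real" where
  "contraction n F j k = (\<Sum>i<n. F i j k i)"

text \<open>
  Up to a factor, the image of \<open>C\<close> under the adjoint of \<^term>\<open>contraction n\<close> on tensors that are
  symmetric in the first two and antisymmetric in the last two indices; subtracting it removes the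
  trace.
\<close>

definition metric_insertion :: "(nat \<Rightarrow> nat \<Rightarrow> real) \<Rightarrow> tensor" where
  "metric_insertion C i j k l =
     C j k * of_bool (i = l) - C j l * of_bool (i = k)
   + C i k * of_bool (j = l) - C i l * of_bool (j = k)"

definition trace_free :: "nat \<Rightarrow> tensor \<Rightarrow> tensor" where
  "trace_free n F i j k l = F i j k l - metric_insertion (contraction n F) i j k l / n"

definition hook_symmetric :: "tensor \<Rightarrow> bool" where
  "hook_symmetric F \<longleftrightarrow> (\<forall>i j k l. F i j k l = F j i k l \<and> F i j k l = - F i j l k)"

lemma sum_of_bool_eq:
  fixes n :: nat
  shows
  "(\<Sum>l<n. f l * of_bool (i = l)) = (if i < n then f i else (0::real))"
  "(\<Sum>l<n. f l * of_bool (l = i)) = (if i < n then f i else (0::real))"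
proof -
  have "(\<lambda>l. f l * of_bool (i = l)) = (\<lambda>l. if l = i then f l else 0)"
    "(\<lambda>l. f l * of_bool (l = i)) = (\<lambda>l. if l = i then f l else 0)"
    by auto
  then show "(\<Sum>l<n. f l * of_bool (i = l)) = (if i < n then f i else 0)"
    "(\<Sum>l<n. f l * of_bool (l = i)) = (if i < n then f i else 0)"
    by (simp_all only: sum.delta[OF finite_lessThan] lessThan_iff)
qed

text \<open>
  Each of the four terms of the insertion contributes the same amount, because the symmetries of
  \<open>F\<close> carry them into one another.
\<close>

lemma tensor_inner_metric_insertion:
  assumes "hook_symmetric F"
  shows "tensor_inner n F (metric_insertion C) = 4 * (\<Sum>j<n. \<Sum>k<n. contraction n F j k * C j k)"
proof -
  have s: "F i j k l = F j i k l" "F i j k l = - F i j l k" for i j k l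
    using assms unfolding hook_symmetric_def by blast+
  let ?c = "\<Sum>j<n. \<Sum>k<n. contraction n F j k * C j k"
  have c: "?c = (\<Sum>j<n. \<Sum>k<n. \<Sum>i<n. F i j k i * C j k)"
    by (simp add: contraction_def sum_distrib_right)
  have 1: "tensor_inner n F (\<lambda>i j k l. C j k * of_bool (i = l)) = ?c"
  proof -
    have "tensor_inner n F (\<lambda>i j k l. C j k * of_bool (i = l)) = (\<Sum>i<n. \<Sum>j<n. \<Sum>k<n. F i j k i * C j k)"
      unfolding tensor_inner_def mult.assoc[symmetric] by (simp add: sum_of_bool_eq)
    also have "\<dots> = (\<Sum>j<n. \<Sum>i<n. \<Sum>k<n. F i j k i * C j k)"
      by (rule sum.swap)
    also have "\<dots> = ?c"
      unfolding c by (intro sum.cong refl sum.swap)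
    finally show ?thesis .
  qed
  have 2: "tensor_inner n F (\<lambda>i j k l. C j l * of_bool (i = k)) = - ?c"
  proof -
    have "tensor_inner n F (\<lambda>i j k l. C j l * of_bool (i = k))
        = (\<Sum>i<n. \<Sum>j<n. \<Sum>l<n. \<Sum>k<n. F i j k l * (C j l * of_bool (i = k)))"
      unfolding tensor_inner_def by (intro sum.cong refl sum.swap)
    also have "\<dots> = (\<Sum>i<n. \<Sum>j<n. \<Sum>l<n. \<Sum>k<n. - F i j l k * (C j l * of_bool (i = k)))"
      by (intro sum.cong refl) (metis s(2))
    also have "\<dots> = - tensor_inner n F (\<lambda>i j k l. C j k * of_bool (i = l))"
      by (simp add: tensor_inner_def sum_negf)
    finally show ?thesis using 1 by simp
  qed
  have swap: "tensor_inner n F (\<lambda>i j k l. H j i k l) = tensor_inner n F H" for H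
  proof -
    have "tensor_inner n F (\<lambda>i j k l. H j i k l) = (\<Sum>j<n. \<Sum>i<n. \<Sum>k<n. \<Sum>l<n. F i j k l * H j i k l)"
      unfolding tensor_inner_def by (rule sum.swap)
    also have "\<dots> = tensor_inner n F H"
      unfolding tensor_inner_def by (intro sum.cong refl) (metis s(1))
    finally show ?thesis .
  qed
  have 3: "tensor_inner n F (\<lambda>i j k l. C i k * of_bool (j = l)) = ?c"
    using swap[of "\<lambda>i j k l. C j k * of_bool (i = l)"] 1 by simp
  have 4: "tensor_inner n F (\<lambda>i j k l. C i l * of_bool (j = k)) = - ?c"
    using swap[of "\<lambda>i j k l. C j l * of_bool (i = k)"] 2 by simp
  have "metric_insertion C = (\<lambda>i j k l. C j k * of_bool (i = l) - C j l * of_bool (i = k)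
      + C i k * of_bool (j = l) - C i l * of_bool (j = k))"
    by (intro ext) (simp add: metric_insertion_def)
  then show ?thesis
    by (simp only: tensor_inner_linear 1 2 3 4)
qed

lemma contraction_metric_insertion:
  assumes "(\<Sum>i<n. C i i) = 0" "j < n" "k < n"
  shows "contraction n (metric_insertion C) j k = n * C j k"
  using assms
  by (simp add: contraction_def metric_insertion_def sum_subtractf sum.distrib sum_of_bool_eq
      flip: sum_distrib_right)

lemma hook_symmetric_trace_free: "hook_symmetric F \<Longrightarrow> hook_symmetric (trace_free n F)"
  unfolding hook_symmetric_def trace_free_def metric_insertion_def
  by (smt (verit, ccfv_SIG) diff_divide_distrib minus_divide_left)

lemma contraction_trace_free:
  assumes "n > 0" "(\<Sum>i<n. contraction n F i i) = 0" "j < n" "k < n"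
  shows "contraction n (trace_free n F) j k = 0"
proof -
  have "contraction n (trace_free n F) j k
      = contraction n F j k - contraction n (metric_insertion (contraction n F)) j k / n"
    by (simp add: contraction_def[of n "trace_free n F"] trace_free_def sum_subtractf
        contraction_def[of n "metric_insertion _"] contraction_def[of n F] sum_divide_distrib)
  then show ?thesis
    using contraction_metric_insertion[where C = "contraction n F" and j = j and k = k and n = n] assms by simp
qed

text \<open>
  Removing the trace is an orthogonal projection, so the trace-free part of one factor does not see
  the trace part of the other. The subtracted term carries the factor \<open>1 / n\<close>; it is the source
  of the dependence of the bound on the dimension.
\<close>

lemma tensor_inner_trace_free:
  assumes "n > 0" and F: "hook_symmetric F" "(\<Sum>i<n. contraction n F i i) = 0"
    and G: "hook_symmetric G" 
  shows "tensor_inner n (trace_free n F) (trace_free n G)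
       = tensor_inner n F G - 4 / n * (\<Sum>j<n. \<Sum>k<n. contraction n F j k * contraction n G j k)"
proof -
  have tf: "trace_free n G = (\<lambda>i j k l. G i j k l - (1 / n) * metric_insertion (contraction n G) i j k l)" for G
    by (intro ext) (simp add: trace_free_def)
  have "tensor_inner n (trace_free n F) (metric_insertion (contraction n G)) = 0"
    using assms by (simp add: tensor_inner_metric_insertion hook_symmetric_trace_free contraction_trace_free)
  then have "tensor_inner n (trace_free n F) (trace_free n G) = tensor_inner n (trace_free n F) G"
    by (subst tf[of G], subst tensor_inner_diff_right, subst tensor_inner_scale_right) simp
  also have "\<dots> = tensor_inner n F G - (1 / n) * tensor_inner n (metric_insertion (contraction n F)) G"
    by (subst tf[of F]) (simp only: tensor_inner_linear)
  also have "tensor_inner n (metric_insertion (contraction n F)) G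
      = 4 * (\<Sum>j<n. \<Sum>k<n. contraction n F j k * contraction n G j k)"
    by (subst tensor_inner_commute) (simp add: tensor_inner_metric_insertion[OF G] mult.commute)
  finally show ?thesis by simp
qed


section \<open>The two tensor kernels\<close>

definition matrix_inner :: "nat \<Rightarrow> (nat \<Rightarrow> nat \<Rightarrow> real) \<Rightarrow> (nat \<Rightarrow> nat \<Rightarrow> real) \<Rightarrow> real" where
  "matrix_inner n A B = (\<Sum>j<n. \<Sum>k<n. A j k * B j k)"

lemma matrix_inner_linear:
  "matrix_inner n A (\<lambda>j k. B j k + C j k) = matrix_inner n A B + matrix_inner n A C"
  "matrix_inner n A (\<lambda>j k. B j k - C j k) = matrix_inner n A B - matrix_inner n A C"
  "matrix_inner n A (\<lambda>j k. c * B j k) = c * matrix_inner n A B"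
  "matrix_inner n (\<lambda>j k. B j k + C j k) A = matrix_inner n B A + matrix_inner n C A"
  "matrix_inner n (\<lambda>j k. B j k - C j k) A = matrix_inner n B A - matrix_inner n C A"
  "matrix_inner n (\<lambda>j k. c * B j k) A = c * matrix_inner n B A"
  by (simp_all add: matrix_inner_def algebra_simps sum.distrib sum_subtractf sum_distrib_left)

lemma matrix_inner_outer:
  "matrix_inner n (\<lambda>j k. a j * b k) (\<lambda>j k. c j * d k) = dot_prod n a c * dot_prod n b d"
  by (simp add: matrix_inner_def dot_prod_def sum_product mult_ac)

lemma tensor_inner_outer:
  "tensor_inner n (\<lambda>i j k l. a i * b j * c k * d l) (\<lambda>i j k l. e i * f j * g k * h l)
   = dot_prod n a e * dot_prod n b f * dot_prod n c g * dot_prod n d h"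
proof -
  have pr: "dot_prod n a e * dot_prod n b f = (\<Sum>i<n. \<Sum>j<n. (a i * e i) * (b j * f j))" for a e b f
    by (simp only: dot_prod_def sum_product)
  have "dot_prod n a e * dot_prod n b f * dot_prod n c g * dot_prod n d h
      = (\<Sum>i<n. \<Sum>j<n. (a i * e i) * (b j * f j)) * (\<Sum>k<n. \<Sum>l<n. (c k * g k) * (d l * h l))"
    unfolding pr[of a e b f, symmetric] pr[of c g d h, symmetric] by (rule mult.assoc)
  also have "\<dots> = (\<Sum>i<n. \<Sum>j<n. (a i * e i) * (b j * f j) * (\<Sum>k<n. \<Sum>l<n. (c k * g k) * (d l * h l)))"
    by (simp only: sum_distrib_right)
  also have "\<dots> = tensor_inner n (\<lambda>i j k l. a i * b j * c k * d l) (\<lambda>i j k l. e i * f j * g k * h l)"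
    unfolding tensor_inner_def sum_distrib_left
    by (intro sum.cong refl) (simp only: mult_ac)
  finally show ?thesis by simp
qed

text \<open>
  This is \<open>(x \<bullet> y) (x \<otimes> x - y \<otimes> y) \<otimes> (x \<and> y)\<close>. Exchanging \<open>x\<close> and \<open>y\<close>
  changes the sign of the second and of the third factor, so the tensor depends on the set
  \<open>{x, y}\<close> only, and the scalar factor makes it invariant under \<open>x \<mapsto> - x\<close> and \<open>y \<mapsto> - y\<close>: it sees lines,
  not vectors.
\<close>

definition hook_tensor :: "nat \<Rightarrow> (nat \<Rightarrow> real) \<Rightarrow> (nat \<Rightarrow> real) \<Rightarrow> tensor" where
  "hook_tensor n x y i j k l = dot_prod n x y * ((x i * x j - y i * y j) * (x k * y l - y k * x l))"

lemma hook_symmetric_hook_tensor: "hook_symmetric (hook_tensor n x y)"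
  by (simp add: hook_symmetric_def hook_tensor_def algebra_simps)

lemma contraction_hook_tensor:
  assumes "dot_prod n x x = 1" "dot_prod n y y = 1"
  shows "contraction n (hook_tensor n x y) j k
    = dot_prod n x y * (dot_prod n x y * (x j * x k + y j * y k) - (x j * y k + y j * x k))"
proof -
  have "contraction n (hook_tensor n x y) j k = dot_prod n x y *
      (x j * x k * (\<Sum>i<n. x i * y i) - x j * y k * (\<Sum>i<n. x i * x i)
       - y j * x k * (\<Sum>i<n. y i * y i) + y j * y k * (\<Sum>i<n. x i * y i))"
    unfolding contraction_def hook_tensor_def sum_distrib_left right_diff_distrib left_diff_distrib
      distrib_left distrib_right sum.distrib[symmetric] sum_subtractf[symmetric]
    by (intro sum.cong refl) (simp add: algebra_simps)
  then show ?thesis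
    using assms unfolding dot_prod_def[symmetric] by (simp add: algebra_simps)
qed

text \<open>
  The contraction is again trace-free, so a single metric insertion removes the whole trace part.
\<close>

lemma trace_contraction_hook_tensor:
  assumes "dot_prod n x x = 1" "dot_prod n y y = 1"
  shows "(\<Sum>i<n. contraction n (hook_tensor n x y) i i) = 0"
proof -
  have "(\<Sum>i<n. contraction n (hook_tensor n x y) i i) = dot_prod n x y *
      (dot_prod n x y * (dot_prod n x x + dot_prod n y y) - 2 * dot_prod n x y)"
    unfolding contraction_hook_tensor[OF assms]
    by (simp add: dot_prod_def sum_distrib_left[symmetric] sum_subtractf sum.distrib mult.commute)
  then show ?thesis using assms by simp
qed

lemma tensor_inner_hook_tensor:
  assumes "n > 0" "dot_prod n x x = 1" "dot_prod n y y = 1" "dot_prod n u u = 1" "dot_prod n v v = 1"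
  defines "xu \<equiv> dot_prod n x u" and "xv \<equiv> dot_prod n x v"
    and "yu \<equiv> dot_prod n y u" and "yv \<equiv> dot_prod n y v"
    and "t \<equiv> dot_prod n x y" and "t' \<equiv> dot_prod n u v"
  shows "tensor_inner n (trace_free n (hook_tensor n x y)) (trace_free n (hook_tensor n u v))
    = t * t' * (2 * (xu\<^sup>2 - xv\<^sup>2 - yu\<^sup>2 + yv\<^sup>2) * (xu * yv - xv * yu)
        - 4 / n * (t * t' * (xu\<^sup>2 + xv\<^sup>2 + yu\<^sup>2 + yv\<^sup>2) - 2 * t * (xu * xv + yu * yv)
            - 2 * t' * (xu * yu + xv * yv) + 2 * (xu * yv + xv * yu)))"
proof -
  have h: "hook_tensor n x y = (\<lambda>i j k l. dot_prod n x y * (x i * x j * x k * y l - x i * x j * y k * x l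
      - y i * y j * x k * y l + y i * y j * y k * x l))" for x y
    by (intro ext) (simp add: hook_tensor_def algebra_simps)
  have "tensor_inner n (hook_tensor n x y) (hook_tensor n u v)
      = t * t' * (2 * (xu\<^sup>2 - xv\<^sup>2 - yu\<^sup>2 + yv\<^sup>2) * (xu * yv - xv * yu))"
    unfolding h tensor_inner_linear tensor_inner_outer xu_def xv_def yu_def yv_def t_def t'_def
    by (simp add: algebra_simps power2_eq_square)
  moreover have c: "contraction n (hook_tensor n x y) = (\<lambda>j k. dot_prod n x y *
      (dot_prod n x y * (x j * x k + y j * y k) - (x j * y k + y j * x k)))"
    if "dot_prod n x x = 1" "dot_prod n y y = 1" for x y
    by (intro ext contraction_hook_tensor that)
  have "matrix_inner n (contraction n (hook_tensor n x y)) (contraction n (hook_tensor n u v))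
      = t * t' * (t * t' * (xu\<^sup>2 + xv\<^sup>2 + yu\<^sup>2 + yv\<^sup>2) - 2 * t * (xu * xv + yu * yv)
            - 2 * t' * (xu * yu + xv * yv) + 2 * (xu * yv + xv * yu))"
    unfolding c[OF assms(2,3)] c[OF assms(4,5)] matrix_inner_linear matrix_inner_outer
      xu_def xv_def yu_def yv_def t_def t'_def
    by (simp add: algebra_simps power2_eq_square)
  ultimately show ?thesis
    using tensor_inner_trace_free[OF assms(1) hook_symmetric_hook_tensor
        trace_contraction_hook_tensor[OF assms(2,3)] hook_symmetric_hook_tensor[of n u v]]
    by (simp add: matrix_inner_def right_diff_distrib)
qed

text \<open>
  Polarization writes the symmetric product \<open>x\<^sup>2 y\<^sup>2\<close> through fourth powers of
  \<open>x\<close>, \<open>y\<close>, \<open>x + y\<close> and \<open>x - y\<close>. The definition is six times the symmetric tensor \<open>(x\<^sup>2 - y\<^sup>2)\<^sup>2\<close>;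
  in terms of fourth powers all inner products reduce to fourth powers of inner products of vectors.
\<close>

definition quartic_tensor :: "(nat \<Rightarrow> real) \<Rightarrow> (nat \<Rightarrow> real) \<Rightarrow> tensor" where
  "quartic_tensor x y i j k l =
     8 * (x i * x j * x k * x l) + 8 * (y i * y j * y k * y l)
     - (x i + y i) * (x j + y j) * (x k + y k) * (x l + y l)
     - (x i - y i) * (x j - y j) * (x k - y k) * (x l - y l)"

lemma dot_prod_linear:
  "dot_prod n (\<lambda>i. x i + y i) z = dot_prod n x z + dot_prod n y z"
  "dot_prod n (\<lambda>i. x i - y i) z = dot_prod n x z - dot_prod n y z"
  "dot_prod n z (\<lambda>i. x i + y i) = dot_prod n z x + dot_prod n z y"
  "dot_prod n z (\<lambda>i. x i - y i) = dot_prod n z x - dot_prod n z y"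
  by (simp_all add: dot_prod_def algebra_simps sum.distrib sum_subtractf)

lemma tensor_inner_quartic_tensor:
  fixes n :: nat and x y u v :: "nat \<Rightarrow> real"
  defines "xu \<equiv> dot_prod n x u" and "xv \<equiv> dot_prod n x v"
    and "yu \<equiv> dot_prod n y u" and "yv \<equiv> dot_prod n y v"
  shows "tensor_inner n (quartic_tensor x y) (quartic_tensor u v)
    = 36 * (xu^4 + xv^4 + yu^4 + yv^4) - 72 * (xu\<^sup>2 * xv\<^sup>2 + yu\<^sup>2 * yv\<^sup>2 + xu\<^sup>2 * yu\<^sup>2 + xv\<^sup>2 * yv\<^sup>2)
      + 24 * (xu\<^sup>2 * yv\<^sup>2 + xv\<^sup>2 * yu\<^sup>2 + 4 * (xu * xv * yu * yv))"
proof -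
  have q: "quartic_tensor x y = (\<lambda>i j k l. 8 * (x i * x j * x k * x l) + 8 * (y i * y j * y k * y l)
     - (x i + y i) * (x j + y j) * (x k + y k) * (x l + y l)
     - (x i - y i) * (x j - y j) * (x k - y k) * (x l - y l))" for x y
    by (intro ext) (simp add: quartic_tensor_def)
  show ?thesis
    unfolding q tensor_inner_linear
      tensor_inner_outer[of n x x x x] tensor_inner_outer[of n y y y y]
      tensor_inner_outer[of n "\<lambda>i. x i + y i" "\<lambda>i. x i + y i" "\<lambda>i. x i + y i" "\<lambda>i. x i + y i"]
      tensor_inner_outer[of n "\<lambda>i. x i - y i" "\<lambda>i. x i - y i" "\<lambda>i. x i - y i" "\<lambda>i. x i - y i"]
      dot_prod_linear xu_def[symmetric] xv_def[symmetric] yu_def[symmetric] yv_def[symmetric]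
    by algebra
qed

definition tensor_kernel ::
    "nat \<Rightarrow> ((nat \<Rightarrow> real) \<Rightarrow> (nat \<Rightarrow> real) \<Rightarrow> tensor) \<Rightarrow> (nat \<Rightarrow> real) set \<Rightarrow> (nat \<Rightarrow> real) set \<Rightarrow> real" where
  "tensor_kernel n F J J' = tensor_inner n
     (\<lambda>i j k l. pair_sum (\<lambda>x y. F x y i j k l) J) (\<lambda>i j k l. pair_sum (\<lambda>x y. F x y i j k l) J')"

lemma positive_kernel_tensor_kernel:
  assumes "\<And>x y. F x y = F y x" "\<And>x i j k l. F x x i j k l = 0"
    and "\<And>i j k l. continuous_map (sphere_pairs n) euclideanreal (\<lambda>z. F (z 0) (z 1) i j k l)"
  shows "positive_kernel \<alpha> n 2 (tensor_kernel n F)"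
proof -
  have "continuous_map (indep_topology \<alpha> n 2) euclideanreal (\<lambda>J. pair_sum (\<lambda>x y. F x y i j k l) J)"
    for i j k l
  proof -
    have "continuous_map (indep_topology \<alpha> n 2) euclideanreal
        (\<lambda>J. if J = {} then 0 else 0 + pair_sum (\<lambda>x y. F x y i j k l) J)"
      by (rule continuous_map_pair_feature) (use assms in \<open>auto intro: fun_cong\<close>)
    moreover have "(\<lambda>J. if J = {} then 0 else 0 + pair_sum (\<lambda>x y. F x y i j k l) J)
        = pair_sum (\<lambda>x y. F x y i j k l)"
      by auto
    ultimately show ?thesis by simp
  qed
  then show ?thesis
    unfolding tensor_kernel_def[abs_def] tensor_inner_def
    by (intro positive_kernel_sum positive_kernel_feature)
qed

lemma tensor_kernel_doubletons:
  assumes "\<And>x y. F x y = F y x" "\<And>x i j k l. F x x i j k l = 0"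
  shows "tensor_kernel n F {x, y} {u, v} = tensor_inner n (F x y) (F u v)"
proof -
  have "(\<lambda>i j k l. pair_sum (\<lambda>x y. F x y i j k l) {x, y}) = F x y" for x y
    by (intro ext, subst pair_sum_doubleton) (use assms in auto)
  then show ?thesis by (simp add: tensor_kernel_def)
qed

lemma tensor_kernel_small:
  assumes "\<And>x i j k l. F x x i j k l = 0"
  shows "tensor_kernel n F {} J = 0" "tensor_kernel n F J {} = 0"
    "tensor_kernel n F {x} J = 0" "tensor_kernel n F J {x} = 0"
  using assms by (simp_all add: tensor_kernel_def tensor_inner_def pair_sum_def)


section \<open>Positivity and the sums over covers\<close>

definition hook_feature :: "nat \<Rightarrow> (nat \<Rightarrow> real) \<Rightarrow> (nat \<Rightarrow> real) \<Rightarrow> tensor" where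
  "hook_feature n x y = trace_free n (hook_tensor n x y)"

lemma hook_feature_commute: "hook_feature n x y = hook_feature n y x"
proof -
  have "hook_tensor n x y = hook_tensor n y x"
    by (intro ext) (simp add: hook_tensor_def dot_prod_commute[of n x y] algebra_simps)
  then show ?thesis by (simp add: hook_feature_def)
qed

lemma hook_feature_diag: "hook_feature n x x i j k l = 0"
  by (simp add: hook_feature_def trace_free_def hook_tensor_def contraction_def metric_insertion_def)

lemma quartic_tensor_commute: "quartic_tensor x y = quartic_tensor y x"
  by (intro ext) (simp add: quartic_tensor_def algebra_simps)

lemma quartic_tensor_diag: "quartic_tensor x x i j k l = 0"
  by (simp add: quartic_tensor_def algebra_simps)

lemma positive_kernel_hook: "positive_kernel \<alpha> n 2 (tensor_kernel n (hook_feature n))"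
proof (rule positive_kernel_tensor_kernel)
  show "hook_feature n x y = hook_feature n y x" for x y by (rule hook_feature_commute)
  fix i j k l
  note [continuous_intros] = continuous_map_sphere_pairs_coord continuous_map_sphere_pairs_dot
  show "continuous_map (sphere_pairs n) euclideanreal (\<lambda>z. hook_feature n (z 0) (z 1) i j k l)"
  proof (cases "n = 0")
    case True
    then show ?thesis
      by (simp add: hook_feature_def trace_free_def hook_tensor_def contraction_def
          metric_insertion_def dot_prod_def)
  next
    case False
    then show ?thesis
      unfolding hook_feature_def trace_free_def metric_insertion_def contraction_def hook_tensor_def
      by (intro continuous_intros continuous_map_const[THEN iffD2]) auto
  qed
qed (rule hook_feature_diag)

lemma positive_kernel_quartic: "positive_kernel \<alpha> n 2 (tensor_kernel n quartic_tensor)"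
proof (rule positive_kernel_tensor_kernel)
  show "quartic_tensor x y = quartic_tensor y x" for x y by (rule quartic_tensor_commute)
  fix i j k l
  note [continuous_intros] = continuous_map_sphere_pairs_coord
  show "continuous_map (sphere_pairs n) euclideanreal (\<lambda>z. quartic_tensor (z 0) (z 1) i j k l)"
    unfolding quartic_tensor_def
    by (intro continuous_intros continuous_map_const[THEN iffD2]) auto
qed (rule quartic_tensor_diag)

lemma sum_Pow_insert:
  assumes "finite A" "x \<notin> A"
  shows "sum f (Pow (insert x A)) = sum f (Pow A) + (\<Sum>B\<in>Pow A. f (insert x B))"
proof -
  have "inj_on (insert x) (Pow A)" using assms(2) by (auto simp: inj_on_def)
  moreover have "Pow A \<inter> insert x ` Pow A = {}" using assms(2) by auto
  ultimately show ?thesis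
    using assms(1) by (simp add: Pow_insert sum.union_disjoint sum.reindex)
qed

text \<open>
  A set \<open>J'\<close> with \<open>J \<union> J' = S\<close> is \<open>S - J\<close> together with an arbitrary subset of \<open>J\<close>. Indexing by that
  subset makes the sums for small \<open>S\<close> short enough to be expanded.
\<close>

lemma A_op_two:
  assumes "independent_set \<alpha> n S" "finite S"
  shows "A_op \<alpha> n 2 K S = (\<Sum>J\<in>Pow S. if card J \<le> 2 then \<Sum>B\<in>Pow J.
           if card (S - J \<union> B) \<le> 2 then K J (S - J \<union> B) else 0 else 0)"
proof -
  let ?P = "\<lambda>J. {J'. J' \<in> indep_sets \<alpha> n 2 \<and> J \<union> J' = S}"
  have ind: "J \<in> indep_sets \<alpha> n 2 \<longleftrightarrow> card J \<le> 2" if "J \<subseteq> S" for J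
    using assms that finite_subset[OF that assms(2)]
    by (auto simp: indep_sets_def independent_set_def)
  have fin: "finite (?P J)" for J
    by (rule finite_subset[of _ "Pow S"]) (use assms(2) in auto)
  have "{(J, J'). J \<in> indep_sets \<alpha> n 2 \<and> J' \<in> indep_sets \<alpha> n 2 \<and> J \<union> J' = S}
      = Sigma {J \<in> Pow S. card J \<le> 2} ?P"
    using ind by auto
  then have "A_op \<alpha> n 2 K S = (\<Sum>J | J \<in> Pow S \<and> card J \<le> 2. \<Sum>J'\<in>?P J. K J J')"
    unfolding A_op_def using assms(2) fin by (simp add: sum.Sigma)
  also have "\<dots> = (\<Sum>J\<in>Pow S. if card J \<le> 2 then \<Sum>J'\<in>?P J. K J J' else 0)"
    using assms(2) sum.inter_filter[of "Pow S"] by simp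
  also have "\<dots> = (\<Sum>J\<in>Pow S. if card J \<le> 2 then \<Sum>B\<in>Pow J.
           if card (S - J \<union> B) \<le> 2 then K J (S - J \<union> B) else 0 else 0)"
  proof (intro sum.cong refl)
    fix J assume "J \<in> Pow S"
    then have J: "J \<subseteq> S" "finite J" using finite_subset assms(2) by auto
    have eq: "?P J = (\<lambda>B. S - J \<union> B) ` {B \<in> Pow J. card (S - J \<union> B) \<le> 2}"
    proof (intro subset_antisym subsetI)
      fix J' assume "J' \<in> ?P J"
      then have "J' = S - J \<union> (J' \<inter> J)" "card J' \<le> 2" using ind by auto
      then show "J' \<in> (\<lambda>B. S - J \<union> B) ` {B \<in> Pow J. card (S - J \<union> B) \<le> 2}"
        by (intro image_eqI[of _ _ "J' \<inter> J"]) auto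
    next
      fix J' assume "J' \<in> (\<lambda>B. S - J \<union> B) ` {B \<in> Pow J. card (S - J \<union> B) \<le> 2}"
      then obtain B where B: "B \<subseteq> J" "card (S - J \<union> B) \<le> 2" "J' = S - J \<union> B" by auto
      then have "J' \<subseteq> S" "J \<union> J' = S" using J by auto
      then show "J' \<in> ?P J" using ind[of J'] B by auto
    qed
    have "inj_on (\<lambda>B. S - J \<union> B) {B \<in> Pow J. card (S - J \<union> B) \<le> 2}"
      by (auto simp: inj_on_def)
    then have "(\<Sum>J'\<in>?P J. K J J') = (\<Sum>B | B \<in> Pow J \<and> card (S - J \<union> B) \<le> 2. K J (S - J \<union> B))"
      unfolding eq by (simp add: sum.reindex)
    also have "\<dots> = (\<Sum>B\<in>Pow J. if card (S - J \<union> B) \<le> 2 then K J (S - J \<union> B) else 0)"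
      using J(2) sum.inter_filter[of "Pow J"] by simp
    finally show "(if card J \<le> 2 then \<Sum>J'\<in>?P J. K J J' else 0)
        = (if card J \<le> 2 then \<Sum>B\<in>Pow J. if card (S - J \<union> B) \<le> 2 then K J (S - J \<union> B) else 0 else 0)"
      by simp
  qed
  finally show ?thesis .
qed

lemma A_op_singleton:
  assumes "independent_set \<alpha> n {x}"
  shows "A_op \<alpha> n 2 K {x} = K {} {x} + K {x} {} + K {x} {x}"
  by (simp add: A_op_two[OF assms] sum_Pow_insert insert_Diff_if)

lemma A_op_doubleton:
  assumes "independent_set \<alpha> n {x, y}" "x \<noteq> y"
  shows "A_op \<alpha> n 2 K {x, y} = K {} {x, y} + K {x, y} {} + K {x} {y} + K {y} {x}
    + K {x} {x, y} + K {x, y} {x} + K {y} {x, y} + K {x, y} {y} + K {x, y} {x, y}"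
  using assms by (simp add: A_op_two[OF assms(1)] sum_Pow_insert insert_Diff_if insert_commute[of y x "{}"])

lemma A_op_triple:
  assumes "independent_set \<alpha> n {x, y, z}" "x \<noteq> y" "x \<noteq> z" "y \<noteq> z"
  shows "A_op \<alpha> n 2 K {x, y, z}
    = K {x} {y, z} + K {y, z} {x} + K {y} {x, z} + K {x, z} {y} + K {z} {x, y} + K {x, y} {z}
    + K {x, y} {x, z} + K {x, z} {x, y} + K {x, y} {y, z} + K {y, z} {x, y}
    + K {x, z} {y, z} + K {y, z} {x, z}"
  using assms by (simp add: A_op_two[OF assms(1)] sum_Pow_insert card_insert_if insert_Diff_if
      insert_commute[of y x "{}"] insert_commute[of z x "{}"] insert_commute[of z y "{}"])

lemma A_op_quadruple:
  assumes "independent_set \<alpha> n {x, y, z, w}"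
    "x \<noteq> y" "x \<noteq> z" "x \<noteq> w" "y \<noteq> z" "y \<noteq> w" "z \<noteq> w"
  shows "A_op \<alpha> n 2 K {x, y, z, w}
    = K {x, y} {z, w} + K {z, w} {x, y} + K {x, z} {y, w} + K {y, w} {x, z}
    + K {x, w} {y, z} + K {y, z} {x, w}"
  using assms by (simp add: A_op_two[OF assms(1)] sum_Pow_insert card_insert_if insert_Diff_if)


section \<open>Values on pairs that meet\<close>

lemma inner_same_pair:
  assumes "n > 0" "0 < \<alpha>" "\<alpha> < 1" "dot_prod n x x = 1" "dot_prod n y y = 1"
    and "dot_prod n x y = \<alpha> \<or> dot_prod n x y = - \<alpha>"
  shows "tensor_inner n (hook_feature n x y) (hook_feature n x y) \<le> 4 * \<alpha>\<^sup>2"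
    and "tensor_inner n (quartic_tensor x y) (quartic_tensor x y) \<le> 96"
proof -
  have t: "(dot_prod n x y)\<^sup>2 = \<alpha>\<^sup>2" and c: "dot_prod n y x = dot_prod n x y"
    using assms by (auto simp: dot_prod_commute)
  define t where "t = dot_prod n x y"
  have a: "0 \<le> \<alpha>\<^sup>2" "\<alpha>\<^sup>2 \<le> 1" using assms by (auto simp: power_le_one)
  have t2: "t * t = \<alpha>\<^sup>2" using t by (simp add: t_def power2_eq_square)
  have "tensor_inner n (hook_feature n x y) (hook_feature n x y)
      = 4 * \<alpha>\<^sup>2 * (1 - \<alpha>\<^sup>2)\<^sup>2 - 8 / n * (\<alpha>\<^sup>2 * (1 - \<alpha>\<^sup>2)\<^sup>2)"
    unfolding hook_feature_def tensor_inner_hook_tensor[OF assms(1,4,5,4,5)] assms(4,5) c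
      t_def[symmetric] t2[symmetric]
    by (simp add: power2_eq_square algebra_simps)
  also have "\<dots> \<le> 4 * \<alpha>\<^sup>2 * (1 - \<alpha>\<^sup>2)\<^sup>2"
    by simp
  also have "\<dots> \<le> 4 * \<alpha>\<^sup>2 * 1"
    using a by (intro mult_left_mono) (auto simp: power_le_one)
  finally show "tensor_inner n (hook_feature n x y) (hook_feature n x y) \<le> 4 * \<alpha>\<^sup>2" by simp
  have "tensor_inner n (quartic_tensor x y) (quartic_tensor x y) = 96 * (1 - \<alpha>\<^sup>2)\<^sup>2"
    unfolding tensor_inner_quartic_tensor assms(4,5) c t_def[symmetric] t2[symmetric] power_one by algebra
  also have "\<dots> \<le> 96 * 1"
    using a by (intro mult_left_mono) (auto simp: power_le_one)
  finally show "tensor_inner n (quartic_tensor x y) (quartic_tensor x y) \<le> 96" by simp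
qed

text \<open>
  The sign \<open>s = p q r\<close> of the triangle decides: without the trace term the first inner product is
  \<open>2 \<alpha>\<^sup>2 (1 - \<alpha>\<^sup>2) (\<alpha> s - \<alpha>\<^sup>2)\<close>, which is positive for \<open>s = 1\<close> and negative for \<open>s = - 1\<close>. The bound
  is the leading value for \<open>s = 1\<close> plus a crude estimate of the trace term.
\<close>

lemma inner_shared_point:
  assumes "n > 0" "0 < \<alpha>" "\<alpha> < 1"
    and unit: "dot_prod n x x = 1" "dot_prod n y y = 1" "dot_prod n z z = 1"
    and xy: "dot_prod n x y = \<alpha> \<or> dot_prod n x y = - \<alpha>"
    and xz: "dot_prod n x z = \<alpha> \<or> dot_prod n x z = - \<alpha>"
    and yz: "dot_prod n y z = \<alpha> \<or> dot_prod n y z = - \<alpha>"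
  shows "tensor_inner n (hook_feature n x y) (hook_feature n x z)
           \<le> 2 * \<alpha>\<^sup>2 * (\<alpha> * (1 - \<alpha>) * (1 - \<alpha>\<^sup>2) + 20 / n)"
    and "tensor_inner n (quartic_tensor x y) (quartic_tensor x z) \<le> 36"
proof -
  obtain p q r where pqr: "dot_prod n x y = \<alpha> * p" "dot_prod n x z = \<alpha> * q" "dot_prod n y z = \<alpha> * r"
      "p = 1 \<or> p = -1" "q = 1 \<or> q = -1" "r = 1 \<or> r = -1"
    using xy xz yz by (metis mult.right_neutral mult_minus_right)
  define s where "s = p * q * r"
  have sq: "p * p = 1" "q * q = 1" "r * r = 1" and s: "s = 1 \<or> s = -1"
    using pqr by (auto simp: s_def)
  have c: "dot_prod n y x = dot_prod n x y" by (rule dot_prod_commute)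
  have a: "0 \<le> \<alpha>\<^sup>2" "\<alpha>\<^sup>2 \<le> 1" using assms by (auto simp: power_le_one)
  define X where "X = s * (2 * \<alpha> - 4 * \<alpha>^3) - \<alpha>\<^sup>2 + 3 * \<alpha>^4"
  have "tensor_inner n (hook_feature n x y) (hook_feature n x z)
      = 2 * \<alpha>\<^sup>2 * ((1 - \<alpha>\<^sup>2) * (\<alpha> * s - \<alpha>\<^sup>2)) - 4 / n * (\<alpha>\<^sup>2 * X)"
  proof -
    have *: "p * q * (2 * (1 - \<alpha>\<^sup>2) * (\<alpha> * r - \<alpha>\<^sup>2 * p * q)
         - d * (p * q * \<alpha>\<^sup>2 * (1 + 3 * \<alpha>\<^sup>2) - 4 * \<alpha>\<^sup>2 * p * q - 4 * \<alpha>^3 * r + 2 * \<alpha> * r + 2 * \<alpha>\<^sup>2 * p * q))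
      = 2 * ((1 - \<alpha>\<^sup>2) * (\<alpha> * s - \<alpha>\<^sup>2)) - d * X" for d
      unfolding X_def s_def using sq by algebra
    have sq': "p\<^sup>2 = 1" "q\<^sup>2 = 1" "r\<^sup>2 = 1" using sq by (simp_all add: power2_eq_square)
    have "tensor_inner n (hook_feature n x y) (hook_feature n x z)
      = \<alpha> * p * (\<alpha> * q) * (2 * (1\<^sup>2 - (\<alpha> * q)\<^sup>2 - (\<alpha> * p)\<^sup>2 + (\<alpha> * r)\<^sup>2) * (1 * (\<alpha> * r) - \<alpha> * q * (\<alpha> * p))
        - 4 / n * (\<alpha> * p * (\<alpha> * q) * (1\<^sup>2 + (\<alpha> * q)\<^sup>2 + (\<alpha> * p)\<^sup>2 + (\<alpha> * r)\<^sup>2) - 2 * (\<alpha> * p) * (1 * (\<alpha> * q) + \<alpha> * p * (\<alpha> * r))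
            - 2 * (\<alpha> * q) * (1 * (\<alpha> * p) + \<alpha> * q * (\<alpha> * r)) + 2 * (1 * (\<alpha> * r) + \<alpha> * q * (\<alpha> * p))))"
      unfolding hook_feature_def tensor_inner_hook_tensor[OF assms(1) unit(1,2,1,3)] unit c pqr(1-3)
      by simp
    also have "\<dots> = \<alpha>\<^sup>2 * (p * q * (2 * (1 - \<alpha>\<^sup>2) * (\<alpha> * r - \<alpha>\<^sup>2 * p * q)
         - 4 / n * (p * q * \<alpha>\<^sup>2 * (1 + 3 * \<alpha>\<^sup>2) - 4 * \<alpha>\<^sup>2 * p * q - 4 * \<alpha>^3 * r + 2 * \<alpha> * r + 2 * \<alpha>\<^sup>2 * p * q)))"
      unfolding power_one using sq by algebra
    finally show ?thesis unfolding * by (simp add: algebra_simps)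
  qed
  moreover have "\<bar>X\<bar> \<le> 10"
  proof -
    have "\<alpha>^3 \<le> 1" "0 \<le> \<alpha>^3" "\<alpha>^4 \<le> 1" "0 \<le> \<alpha>^4" using assms by (auto simp: power_le_one)
    moreover have "s * (2 * \<alpha> - 4 * \<alpha>^3) = 2 * \<alpha> - 4 * \<alpha>^3 \<or> s * (2 * \<alpha> - 4 * \<alpha>^3) = - (2 * \<alpha> - 4 * \<alpha>^3)"
      using s by auto
    ultimately show ?thesis
      using a assms(2,3) unfolding X_def by linarith
  qed
  then have "- (4 / n * (\<alpha>\<^sup>2 * X)) \<le> 4 / n * (\<alpha>\<^sup>2 * 10)"
    unfolding mult_minus_right[symmetric] using a by (intro mult_left_mono) auto
  moreover have "(1 - \<alpha>\<^sup>2) * (\<alpha> * s - \<alpha>\<^sup>2) \<le> (1 - \<alpha>\<^sup>2) * (\<alpha> * (1 - \<alpha>))"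
    using a s assms(2) by (intro mult_left_mono) (auto simp: power2_eq_square algebra_simps)
  then have "2 * \<alpha>\<^sup>2 * ((1 - \<alpha>\<^sup>2) * (\<alpha> * s - \<alpha>\<^sup>2)) \<le> 2 * \<alpha>\<^sup>2 * ((1 - \<alpha>\<^sup>2) * (\<alpha> * (1 - \<alpha>)))"
    by (rule mult_left_mono) simp
  ultimately show "tensor_inner n (hook_feature n x y) (hook_feature n x z)
           \<le> 2 * \<alpha>\<^sup>2 * (\<alpha> * (1 - \<alpha>) * (1 - \<alpha>\<^sup>2) + 20 / n)"
    by (simp add: algebra_simps)
  have "tensor_inner n (quartic_tensor x y) (quartic_tensor x z)
      = 36 * (1 - \<alpha>\<^sup>2)\<^sup>2 - 48 * (\<alpha> * p - \<alpha>\<^sup>2 * q * r)\<^sup>2"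
    unfolding tensor_inner_quartic_tensor unit c pqr(1-3) power_one using sq by algebra
  also have "\<dots> \<le> 36 * (1 - \<alpha>\<^sup>2)\<^sup>2" by simp
  also have "\<dots> \<le> 36 * 1"
    using a by (intro mult_left_mono) (auto simp: power_le_one)
  finally show "tensor_inner n (quartic_tensor x y) (quartic_tensor x z) \<le> 36" by simp
qed


section \<open>Values on disjoint pairs\<close>

text \<open>
  The inner product of the contracted hook tensors of \<open>{x, y}\<close> and \<open>{u, v}\<close>, divided by \<open>\<alpha>\<^sup>2\<close>, in
  terms of signs: \<open>p\<close> and \<open>q\<close> belong to the two pairs and \<open>e, f, g, h\<close> to the four inner products
  between them.
\<close>

definition pairing_value :: "real \<Rightarrow> real \<Rightarrow> real \<Rightarrow> real \<Rightarrow> real \<Rightarrow> real \<Rightarrow> real \<Rightarrow> real" where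
  "pairing_value \<alpha> p q e f g h = 4 * \<alpha>^4 - 2 * \<alpha>^3 * (q * (e * f + g * h) + p * (e * g + f * h))
     + 2 * \<alpha>\<^sup>2 * (p * q * (e * h + f * g))"

text \<open>
  All four inner products between the pairs have square \<open>\<alpha>\<^sup>2\<close>, hence \<open>x \<otimes> x - y \<otimes> y\<close> and
  \<open>u \<otimes> u - v \<otimes> v\<close> are orthogonal. Only the trace term of the hook tensors survives, and it is of order
  \<open>1 / n\<close>.
\<close>

lemma inner_disjoint_pairs:
  assumes "n > 0"
    and unit: "dot_prod n x x = 1" "dot_prod n y y = 1" "dot_prod n u u = 1" "dot_prod n v v = 1"
    and d: "dot_prod n x y = \<alpha> * p" "dot_prod n u v = \<alpha> * q" "dot_prod n x u = \<alpha> * e"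
      "dot_prod n x v = \<alpha> * f" "dot_prod n y u = \<alpha> * g" "dot_prod n y v = \<alpha> * h"
    and s: "p * p = 1" "q * q = 1" "e * e = 1" "f * f = 1" "g * g = 1" "h * h = 1"
  shows "tensor_inner n (hook_feature n x y) (hook_feature n u v)
           = - (4 * \<alpha>\<^sup>2 / n) * pairing_value \<alpha> p q e f g h"
    and "tensor_inner n (quartic_tensor x y) (quartic_tensor u v) = 96 * \<alpha>^4 * (e * f * g * h - 1)"
proof -
  have *: "\<alpha> * p * (\<alpha> * q) * (2 * ((\<alpha> * e)\<^sup>2 - (\<alpha> * f)\<^sup>2 - (\<alpha> * g)\<^sup>2 + (\<alpha> * h)\<^sup>2) * (\<alpha> * e * (\<alpha> * h) - \<alpha> * f * (\<alpha> * g))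
        - c * (\<alpha> * p * (\<alpha> * q) * ((\<alpha> * e)\<^sup>2 + (\<alpha> * f)\<^sup>2 + (\<alpha> * g)\<^sup>2 + (\<alpha> * h)\<^sup>2)
            - 2 * (\<alpha> * p) * (\<alpha> * e * (\<alpha> * f) + \<alpha> * g * (\<alpha> * h))
            - 2 * (\<alpha> * q) * (\<alpha> * e * (\<alpha> * g) + \<alpha> * f * (\<alpha> * h)) + 2 * (\<alpha> * e * (\<alpha> * h) + \<alpha> * f * (\<alpha> * g))))
     = - (c * \<alpha>\<^sup>2) * pairing_value \<alpha> p q e f g h" for c
    unfolding pairing_value_def using s by algebra
  show "tensor_inner n (hook_feature n x y) (hook_feature n u v)
           = - (4 * \<alpha>\<^sup>2 / n) * pairing_value \<alpha> p q e f g h"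
    unfolding hook_feature_def tensor_inner_hook_tensor[OF assms(1) unit] d * by simp
  show "tensor_inner n (quartic_tensor x y) (quartic_tensor u v) = 96 * \<alpha>^4 * (e * f * g * h - 1)"
    unfolding tensor_inner_quartic_tensor d using s by algebra
qed

text \<open>
  Up to order and signs of the vectors there are three kinds of four-point sets: those with 0, 2 or 4 triangles of
  negative sign. For 0 and 4 all three four-cycles are positive, and the pairing values alone give a
  good bound. For 2 the pairing values may have the wrong sign, but then exactly two four-cycles are
  negative and \<open>Y = - 4\<close>, which is what the quartic kernel turns into a negative contribution.
\<close>

lemma pairing_value_sum:
  fixes \<alpha> :: real
  assumes "0 < \<alpha>" 
    and "p = 1 \<or> p = -1" "q = 1 \<or> q = -1" "e = 1 \<or> e = -1" "f = 1 \<or> f = -1" "g = 1 \<or> g = -1" "h = 1 \<or> h = -1"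
  defines "X \<equiv> pairing_value \<alpha> p q e f g h + pairing_value \<alpha> e h p f g q + pairing_value \<alpha> f g p e h q"
    and "Y \<equiv> (e * f * g * h - 1) + (p * f * g * q - 1) + (p * e * h * q - 1)"
  shows "12 * \<alpha>\<^sup>2 * (1 - \<alpha>)\<^sup>2 \<le> X \<and> Y \<le> 0 \<or> - 4 * \<alpha>\<^sup>2 \<le> X \<and> Y = - 4"
proof -
  have "0 \<le> \<alpha>^3" "0 \<le> \<alpha>^4" "(\<alpha>\<^sup>2) * (1 - \<alpha>)\<^sup>2 = \<alpha>\<^sup>2 - 2 * \<alpha>^3 + \<alpha>^4"
    using assms(1) by (simp_all add: power2_eq_square power3_eq_cube power4_eq_xxxx algebra_simps)
  then show ?thesis
    using assms(2-) unfolding X_def Y_def pairing_value_def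
    by (elim disjE) (simp_all add: mult.assoc)
qed


section \<open>Feasibility of mixed kernels\<close>

definition mixed_kernel :: "nat \<Rightarrow> (nat \<Rightarrow> nat \<Rightarrow> real) \<Rightarrow> real \<Rightarrow> real
    \<Rightarrow> (nat \<Rightarrow> real) set \<Rightarrow> (nat \<Rightarrow> real) set \<Rightarrow> real" where
  "mixed_kernel n T \<beta> \<eta> J J' = T (card J) (card J')
     + \<beta> * tensor_kernel n (hook_feature n) J J' + \<eta> * tensor_kernel n quartic_tensor J J'"

lemma mixed_kernel_small:
  "mixed_kernel n T \<beta> \<eta> {} J = T 0 (card J)" "mixed_kernel n T \<beta> \<eta> J {} = T (card J) 0"
  "mixed_kernel n T \<beta> \<eta> {x} J = T 1 (card J)" "mixed_kernel n T \<beta> \<eta> J {x} = T (card J) 1"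
  by (simp_all add: mixed_kernel_def tensor_kernel_small[of "hook_feature n", OF hook_feature_diag]
      tensor_kernel_small[of quartic_tensor, OF quartic_tensor_diag])

lemma mixed_kernel_doubletons:
  assumes "x \<noteq> y" "u \<noteq> v"
  shows "mixed_kernel n T \<beta> \<eta> {x, y} {u, v} = T 2 2
    + \<beta> * tensor_inner n (hook_feature n x y) (hook_feature n u v)
    + \<eta> * tensor_inner n (quartic_tensor x y) (quartic_tensor u v)"
  using assms
  by (simp add: mixed_kernel_def tensor_kernel_doubletons[of "hook_feature n", OF hook_feature_commute hook_feature_diag]
      tensor_kernel_doubletons[of quartic_tensor, OF quartic_tensor_commute quartic_tensor_diag]
      numeral_2_eq_2)

lemma mixed_kernel_commute:
  assumes "\<And>i j. T i j = T j i"
  shows "mixed_kernel n T \<beta> \<eta> J J' = mixed_kernel n T \<beta> \<eta> J' J"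
  using assms by (simp add: mixed_kernel_def tensor_kernel_def tensor_inner_commute)

lemma positive_kernel_mixed:
  assumes "\<beta> \<ge> 0" "\<eta> \<ge> 0" "positive_kernel \<alpha> n 2 (\<lambda>J J'. T (card J) (card J'))"
  shows "positive_kernel \<alpha> n 2 (mixed_kernel n T \<beta> \<eta>)"
  unfolding mixed_kernel_def[abs_def]
  by (intro positive_kernel_add positive_kernel_scale positive_kernel_hook positive_kernel_quartic assms)

context
  fixes \<alpha> \<beta> \<eta> :: real and n :: nat and T :: "nat \<Rightarrow> nat \<Rightarrow> real"
  assumes \<alpha>: "0 < \<alpha>" "\<alpha> < 1" and n: "n > 0" and nonneg: "\<beta> \<ge> 0" "\<eta> \<ge> 0"
    and T: "\<And>i j. T i j = T j i"
begin

lemma A_op_mixed_singleton: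
  assumes "independent_set \<alpha> n {x}"
  shows "A_op \<alpha> n 2 (mixed_kernel n T \<beta> \<eta>) {x} = 2 * T 0 1 + T 1 1"
  using T[of 1 0] by (simp add: A_op_singleton[OF assms] mixed_kernel_small)

lemma A_op_mixed_doubleton:
  assumes "independent_set \<alpha> n {x, y}" "x \<noteq> y"
  shows "A_op \<alpha> n 2 (mixed_kernel n T \<beta> \<eta>) {x, y}
    \<le> 2 * T 0 2 + 2 * T 1 1 + 4 * T 1 2 + T 2 2 + 4 * \<alpha>\<^sup>2 * \<beta> + 96 * \<eta>"
proof -
  have d: "dot_prod n x x = 1" "dot_prod n y y = 1" "dot_prod n x y = \<alpha> \<or> dot_prod n x y = - \<alpha>"
    using indep_unit[OF assms(1)] indep_dot[OF assms(1), of x y] assms(2) by auto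
  have c: "card {x, y} = 2" using assms(2) by simp
  have "A_op \<alpha> n 2 (mixed_kernel n T \<beta> \<eta>) {x, y}
      = 2 * T 0 2 + 2 * T 1 1 + 4 * T 1 2 + mixed_kernel n T \<beta> \<eta> {x, y} {x, y}"
    unfolding A_op_doubleton[OF assms] mixed_kernel_small c
    using T[of 2 0] T[of 2 1] by simp
  moreover have "\<beta> * tensor_inner n (hook_feature n x y) (hook_feature n x y) \<le> \<beta> * (4 * \<alpha>\<^sup>2)"
    by (intro mult_left_mono inner_same_pair n \<alpha> d nonneg)
  moreover have "\<eta> * tensor_inner n (quartic_tensor x y) (quartic_tensor x y) \<le> \<eta> * 96"
    by (intro mult_left_mono inner_same_pair[OF n \<alpha> d] nonneg)
  ultimately show ?thesis
    unfolding mixed_kernel_doubletons[OF assms(2) assms(2)] by (simp add: mult_ac)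
qed

lemma A_op_mixed_triple:
  assumes "independent_set \<alpha> n {x, y, z}" "x \<noteq> y" "x \<noteq> z" "y \<noteq> z"
  shows "A_op \<alpha> n 2 (mixed_kernel n T \<beta> \<eta>) {x, y, z}
    \<le> 6 * (T 1 2 + T 2 2 + \<beta> * (2 * \<alpha>\<^sup>2 * (\<alpha> * (1 - \<alpha>) * (1 - \<alpha>\<^sup>2) + 20 / n)) + 36 * \<eta>)"
proof -
  let ?K = "mixed_kernel n T \<beta> \<eta>"
  define b where "b = \<beta> * (2 * \<alpha>\<^sup>2 * (\<alpha> * (1 - \<alpha>) * (1 - \<alpha>\<^sup>2) + 20 / n))"
  have comm: "?K J J' = ?K J' J" for J J' by (rule mixed_kernel_commute) (rule T)
  have shared: "?K {u, v} {u, w} \<le> T 2 2 + b + 36 * \<eta>"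
    if "{u, v, w} = {x, y, z}" "u \<noteq> v" "u \<noteq> w" "v \<noteq> w" for u v w
  proof -
    have ind: "independent_set \<alpha> n {u, v, w}" using assms(1) that(1) by simp
    have d: "dot_prod n u u = 1" "dot_prod n v v = 1" "dot_prod n w w = 1"
      "dot_prod n u v = \<alpha> \<or> dot_prod n u v = - \<alpha>" "dot_prod n u w = \<alpha> \<or> dot_prod n u w = - \<alpha>"
      "dot_prod n v w = \<alpha> \<or> dot_prod n v w = - \<alpha>"
      using indep_unit[OF ind] indep_dot[OF ind] that(2-4) by simp_all
    have "\<beta> * tensor_inner n (hook_feature n u v) (hook_feature n u w) \<le> b"
      and "\<eta> * tensor_inner n (quartic_tensor u v) (quartic_tensor u w) \<le> \<eta> * 36"
      unfolding b_def by (intro mult_left_mono inner_shared_point[OF n \<alpha> d] nonneg)+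
    then show ?thesis unfolding mixed_kernel_doubletons[OF that(2,3)] by simp
  qed
  have c: "card {x, y} = 2" "card {x, z} = 2" "card {y, z} = 2" using assms by simp_all
  have "A_op \<alpha> n 2 ?K {x, y, z} = 6 * T 1 2
      + 2 * ?K {x, y} {x, z} + 2 * ?K {y, x} {y, z} + 2 * ?K {z, x} {z, y}"
    unfolding A_op_triple[OF assms] mixed_kernel_small c
    using comm[of "{x, z}" "{x, y}"]
      comm[of "{y, z}" "{x, y}"]
      comm[of "{y, z}" "{x, z}"] T[of 2 1]
    by (simp add: insert_commute[of y x "{}"] insert_commute[of z x "{}"] insert_commute[of z y "{}"])
  moreover have "?K {x, y} {x, z} \<le> T 2 2 + b + 36 * \<eta>" "?K {y, x} {y, z} \<le> T 2 2 + b + 36 * \<eta>"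
    "?K {z, x} {z, y} \<le> T 2 2 + b + 36 * \<eta>"
    by (rule shared; use assms in auto)+
  ultimately show ?thesis unfolding b_def[symmetric] by argo
qed

lemma A_op_mixed_quadruple:
  assumes "independent_set \<alpha> n {x, y, z, w}"
    "x \<noteq> y" "x \<noteq> z" "x \<noteq> w" "y \<noteq> z" "y \<noteq> w" "z \<noteq> w"
  shows "A_op \<alpha> n 2 (mixed_kernel n T \<beta> \<eta>) {x, y, z, w}
      \<le> 6 * T 2 2 - 96 * \<beta> * \<alpha>^4 * (1 - \<alpha>)\<^sup>2 / n
    \<or> A_op \<alpha> n 2 (mixed_kernel n T \<beta> \<eta>) {x, y, z, w} \<le> 6 * T 2 2 + 32 * \<beta> * \<alpha>^4 / n - 768 * \<eta> * \<alpha>^4"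
proof -
  let ?K = "mixed_kernel n T \<beta> \<eta>"
  have comm: "?K J J' = ?K J' J" for J J' by (rule mixed_kernel_commute) (rule T)
  have u: "dot_prod n x x = 1" "dot_prod n y y = 1" "dot_prod n z z = 1" "dot_prod n w w = 1"
    using indep_unit[OF assms(1)] by auto
  have sg: "\<exists>p. (p = 1 \<or> p = -1) \<and> dot_prod n a b = \<alpha> * p" if "a \<in> {x, y, z, w}" "b \<in> {x, y, z, w}" "a \<noteq> b" for a b
    using indep_dot[OF assms(1) that] by (metis mult.right_neutral mult_minus_right)
  obtain p where p: "p = 1 \<or> p = -1" "dot_prod n x y = \<alpha> * p" using sg[of x y] assms by auto
  obtain q where q: "q = 1 \<or> q = -1" "dot_prod n z w = \<alpha> * q" using sg[of z w] assms by auto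
  obtain e where e: "e = 1 \<or> e = -1" "dot_prod n x z = \<alpha> * e" using sg[of x z] assms by auto
  obtain f where f: "f = 1 \<or> f = -1" "dot_prod n x w = \<alpha> * f" using sg[of x w] assms by auto
  obtain g where g: "g = 1 \<or> g = -1" "dot_prod n y z = \<alpha> * g" using sg[of y z] assms by auto
  obtain h where h: "h = 1 \<or> h = -1" "dot_prod n y w = \<alpha> * h" using sg[of y w] assms by auto
  have c: "dot_prod n z y = \<alpha> * g" "dot_prod n w y = \<alpha> * h" "dot_prod n w z = \<alpha> * q"
    using g h q by (simp_all add: dot_prod_commute)
  have sq: "p * p = 1" "q * q = 1" "e * e = 1" "f * f = 1" "g * g = 1" "h * h = 1"
    using p q e f g h by auto
  define X where "X = pairing_value \<alpha> p q e f g h + pairing_value \<alpha> e h p f g q + pairing_value \<alpha> f g p e h q"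
  define Y where "Y = (e * f * g * h - 1) + (p * f * g * q - 1) + (p * e * h * q - 1)"
  have "A_op \<alpha> n 2 ?K {x, y, z, w} = 2 * (?K {x, y} {z, w} + ?K {x, z} {y, w} + ?K {x, w} {y, z})"
    unfolding A_op_quadruple[OF assms]
    using comm[of "{z, w}" "{x, y}"]
      comm[of "{y, w}" "{x, z}"]
      comm[of "{y, z}" "{x, w}"] by simp
  also have "\<dots> = 6 * T 2 2 - (8 * \<alpha>\<^sup>2 * \<beta> / n) * X + 192 * \<alpha>^4 * \<eta> * Y"
    unfolding mixed_kernel_doubletons[OF assms(2,7)] mixed_kernel_doubletons[OF assms(3,6)]
      mixed_kernel_doubletons[OF assms(4,5)]
      inner_disjoint_pairs[OF n u p(2) q(2) e(2) f(2) g(2) h(2) sq]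
      inner_disjoint_pairs[OF n u(1,3,2,4) e(2) h(2) p(2) f(2) c(1) q(2) sq(3,6,1,4,5,2)]
      inner_disjoint_pairs[OF n u(1,4,2,3) f(2) g(2) p(2) e(2) c(2,3) sq(4,5,1,3,6,2)] X_def Y_def
    using n by (simp add: field_simps)
  finally have A: "A_op \<alpha> n 2 ?K {x, y, z, w} = 6 * T 2 2 - (8 * \<alpha>\<^sup>2 * \<beta> / n) * X + 192 * \<alpha>^4 * \<eta> * Y" .
  have nn: "0 \<le> 8 * \<alpha>\<^sup>2 * \<beta> / n" "0 \<le> 192 * \<alpha>^4 * \<eta>" using nonneg by simp_all
  from pairing_value_sum[OF \<alpha>(1) p(1) q(1) e(1) f(1) g(1) h(1), folded X_def Y_def]
  show ?thesis
  proof (elim disjE conjE)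
    assume "12 * \<alpha>\<^sup>2 * (1 - \<alpha>)\<^sup>2 \<le> X" "Y \<le> 0"
    then have "(8 * \<alpha>\<^sup>2 * \<beta> / n) * (12 * \<alpha>\<^sup>2 * (1 - \<alpha>)\<^sup>2) \<le> (8 * \<alpha>\<^sup>2 * \<beta> / n) * X"
      "192 * \<alpha>^4 * \<eta> * Y \<le> 0"
      using nn by (intro mult_left_mono mult_nonneg_nonpos; simp)+
    moreover have "(8 * \<alpha>\<^sup>2 * \<beta> / n) * (12 * \<alpha>\<^sup>2 * (1 - \<alpha>)\<^sup>2) = 96 * \<beta> * \<alpha>^4 * (1 - \<alpha>)\<^sup>2 / n"
      by (simp add: power2_eq_square power4_eq_xxxx)
    ultimately show ?thesis unfolding A by linarith
  next
    assume "- 4 * \<alpha>\<^sup>2 \<le> X" "Y = - 4"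
    then have "(8 * \<alpha>\<^sup>2 * \<beta> / n) * (- 4 * \<alpha>\<^sup>2) \<le> (8 * \<alpha>\<^sup>2 * \<beta> / n) * X"
      using nn by (intro mult_left_mono) simp
    moreover have "(8 * \<alpha>\<^sup>2 * \<beta> / n) * (- 4 * \<alpha>\<^sup>2) = - (32 * \<beta> * \<alpha>^4 / n)"
      by (simp add: power2_eq_square power4_eq_xxxx)
    moreover have "192 * \<alpha>^4 * \<eta> * Y = - (768 * \<eta> * \<alpha>^4)" using \<open>Y = - 4\<close> by simp
    ultimately show ?thesis unfolding A by linarith
  qed
qed

lemma las_feasible_mixed_kernel:
  assumes "positive_kernel \<alpha> n 2 (\<lambda>J J'. T (card J) (card J'))"
    and one: "2 * T 0 1 + T 1 1 \<le> - 1"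
    and two: "2 * T 0 2 + 2 * T 1 1 + 4 * T 1 2 + T 2 2 + 4 * \<alpha>\<^sup>2 * \<beta> + 96 * \<eta> \<le> 0"
    and three: "T 1 2 + T 2 2 + \<beta> * (2 * \<alpha>\<^sup>2 * (\<alpha> * (1 - \<alpha>) * (1 - \<alpha>\<^sup>2) + 20 / n)) + 36 * \<eta> \<le> 0"
    and four: "6 * T 2 2 \<le> 96 * \<beta> * \<alpha>^4 * (1 - \<alpha>)\<^sup>2 / n"
      "6 * T 2 2 + 32 * \<beta> * \<alpha>^4 / n \<le> 768 * \<eta> * \<alpha>^4"
  shows "mixed_kernel n T \<beta> \<eta> \<in> las_feasible \<alpha> 2 n"
  unfolding las_feasible_def
proof (intro CollectI conjI ballI)
  let ?K = "mixed_kernel n T \<beta> \<eta>"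
  show "positive_kernel \<alpha> n 2 ?K"
    by (intro positive_kernel_mixed nonneg assms(1))
  fix S assume "S \<in> indep_sets \<alpha> n (2 * 2) - {{}}"
  then have S: "independent_set \<alpha> n S" "finite S" "card S \<le> 4" "S \<noteq> {}"
    by (auto simp: indep_sets_def)
  have "card S > 0" using S by (simp add: card_gt_0_iff)
  then consider "card S = 1" | "card S = 2" | "card S = 3" | "card S = 4" using S(3) by linarith
  then show "A_op \<alpha> n 2 ?K S \<le> - indicator (indep_singletons \<alpha> n) S"
  proof cases
    case 1
    then obtain x where x: "S = {x}" by (auto simp: card_1_singleton_iff)
    have "A_op \<alpha> n 2 ?K {x} \<le> - 1" using A_op_mixed_singleton[OF S(1)[unfolded x]] one by simp
    moreover have "(indicator (indep_singletons \<alpha> n) S :: real) \<le> 1"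
      by (simp add: indicator_def)
    ultimately show ?thesis unfolding x by linarith
  next
    case 2
    then obtain x y where x: "S = {x, y}" "x \<noteq> y" by (auto simp: card_2_iff)
    have "A_op \<alpha> n 2 ?K S \<le> 0" using A_op_mixed_doubleton[of x y] S(1) x two by fastforce
    then show ?thesis using 2 by (simp add: indep_singletons_def)
  next
    case 3
    then obtain x y z where x: "S = {x, y, z}" "x \<noteq> y" "x \<noteq> z" "y \<noteq> z" by (auto simp: card_3_iff)
    have "A_op \<alpha> n 2 ?K S \<le> 0"
      unfolding x(1)
      by (rule order_trans[OF A_op_mixed_triple[OF S(1)[unfolded x(1)] x(2-4)]]) (use three in simp)
    then show ?thesis using 3 by (simp add: indep_singletons_def)
  next
    case 4
    then have "card S = Suc 3" by simp
    then obtain x B where B: "S = insert x B" "x \<notin> B" "card B = 3"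
      using card_Suc_eq[of S 3] by blast
    then obtain y z w where y: "B = {y, z, w}" "y \<noteq> z" "y \<noteq> w" "z \<noteq> w" by (auto simp: card_3_iff)
    have x: "x \<noteq> y" "x \<noteq> z" "x \<noteq> w" using B(2) y(1) by auto
    have "A_op \<alpha> n 2 ?K S \<le> 0"
      using A_op_mixed_quadruple[OF S(1)[unfolded B(1) y(1)] x y(2-4)] four unfolding B(1) y(1) by linarith
    then show ?thesis using 4 by (simp add: indep_singletons_def)
  qed
qed

end


section \<open>The cardinality kernel and the choice of weights\<close>

definition by_card :: "real \<Rightarrow> real \<Rightarrow> real \<Rightarrow> nat \<Rightarrow> real" where
  "by_card a b c j = (if j = 0 then a else if j = 1 then b else c)"

text \<open>
  Summed over all pairs of subsets of a set of \<open>N\<close> points, the first two squares give to leading order, with \<open>\<nu> = N / M\<close>,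
  \<open>M ((1 - \<nu>/2 - \<nu>\<^sup>2/2)\<^sup>2 + 3/4 (\<nu> - \<nu>\<^sup>2)\<^sup>2) = M (1 - \<nu>)\<^sup>2 (1 + \<nu> + \<nu>\<^sup>2)\<close>. The last two squares are smaller by the
  factor \<open>1 / M\<close>; with \<open>D\<close>, \<open>Q\<close>, \<open>R\<close> chosen in this order and each large compared with the
  previous ones, they contribute negatively to the conditions for three, two and one points.
\<close>

definition card_kernel :: "real \<Rightarrow> real \<Rightarrow> real \<Rightarrow> real \<Rightarrow> nat \<Rightarrow> nat \<Rightarrow> real" where
  "card_kernel M D Q R i j =
     M * (by_card 1 (- 1 / (2 * M)) (- 1 / M\<^sup>2) i * by_card 1 (- 1 / (2 * M)) (- 1 / M\<^sup>2) j)
   + 3 * M / 4 * (by_card 0 (1 / M) (- 2 / M\<^sup>2) i * by_card 0 (1 / M) (- 2 / M\<^sup>2) j)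
   + by_card (- Q) (- D / M) (1 / M\<^sup>2) i * by_card (- Q) (- D / M) (1 / M\<^sup>2) j
   + by_card R (- 1 / M) 0 i * by_card R (- 1 / M) 0 j"

lemma positive_kernel_card_kernel:
  assumes "\<alpha>\<^sup>2 \<noteq> 1" "M \<ge> 0"
  shows "positive_kernel \<alpha> n 2 (\<lambda>J J'. card_kernel M D Q R (card J) (card J'))"
  unfolding card_kernel_def using assms
  by (intro positive_kernel_add positive_kernel_scale positive_kernel_feature continuous_map_card_feature) auto

lemma card_kernel_commute: "card_kernel M D Q R i j = card_kernel M D Q R j i"
  by (simp add: card_kernel_def mult_ac)

lemma card_kernel_values:
  assumes "M > 0"
  shows "card_kernel M D Q R 0 0 = M + Q\<^sup>2 + R\<^sup>2"
    "card_kernel M D Q R 0 1 = - 1 / 2 + (D * Q - R) / M"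
    "card_kernel M D Q R 1 1 = 1 / M + (D\<^sup>2 + 1) / M\<^sup>2"
    "card_kernel M D Q R 0 2 = - 1 / M - Q / M\<^sup>2"
    "card_kernel M D Q R 1 2 = - 1 / M\<^sup>2 - D / M^3"
    "card_kernel M D Q R 2 2 = 4 / M^3 + 1 / M^4"
  using assms
  by (simp_all add: card_kernel_def by_card_def field_simps power2_eq_square power3_eq_cube power4_eq_xxxx)

theorem mainTheorem1:
  fixes \<alpha> :: real
  assumes "0 < \<alpha>" and "\<alpha> < 1"
  shows "\<exists>(c::real) (n0::nat). \<forall>n\<ge>n0.
           las \<alpha> 2 n \<le> ereal (c + (1 + \<alpha>) / (2 * \<alpha>) * real n)"
proof -
  \<comment> \<open>\<open>E\<close>, \<open>D\<close>, \<open>Q\<close>, \<open>R\<close> are chosen to satisfy in turn the second condition for four points and the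
    conditions for three, two and one points.\<close>
  define k where "k = (1 + \<alpha>) / (2 * \<alpha>)"
  define \<gamma> where "\<gamma> = \<alpha> * (1 - \<alpha>) * (1 - \<alpha>\<^sup>2)"
  define E where "E = (30 + 32 * \<alpha>\<^sup>2 * k / \<gamma>) / (768 * \<alpha>^4)"
  define D where "D = 5 + 40 * k / \<gamma> + 36 * E"
  define Q where "Q = D\<^sup>2 + 4 + 1 / \<gamma> + 48 * E"
  define R where "R = D * Q + 1 + D\<^sup>2"
  have a: "0 < \<alpha>\<^sup>2" "\<alpha>\<^sup>2 < 1" using assms by (auto simp: power_less_one_iff)
  have \<gamma>: "\<gamma> > 0" using assms a by (simp add: \<gamma>_def)
  have k: "k \<ge> 1" using assms by (simp add: k_def field_simps)
  have E: "E \<ge> 0" using \<gamma> k by (simp add: E_def)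
  have E\<alpha>: "E * (768 * \<alpha>^4) = 30 + 32 * \<alpha>\<^sup>2 * k / \<gamma>" using assms by (simp add: E_def)
  have k\<gamma>: "\<alpha>\<^sup>2 * (1 - \<alpha>)\<^sup>2 * k / \<gamma> = 1 / 2"
    using assms a \<gamma> by (simp add: k_def \<gamma>_def divide_simps) algebra
  have "las \<alpha> 2 n \<le> ereal (1 + Q\<^sup>2 + R\<^sup>2 + k * real n)" if "n \<ge> 1" for n
  proof -
    \<comment> \<open>The summand 1 leaves room for the term \<open>1 / M^4\<close> in the first condition for four points.\<close>
    define M where "M = k * real n + 1"
    define m where "m = 1 / M"
    \<comment> \<open>\<open>\<beta>\<close> makes the leading terms of the condition for three points cancel.\<close>
    define \<beta> where "\<beta> = m\<^sup>2 / (2 * \<alpha>\<^sup>2 * \<gamma>)"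
    define \<eta> where "\<eta> = E * m^3"
    let ?T = "card_kernel M D Q R"
    have n: "n > 0" "real n \<ge> 1" using that by auto
    have M: "M \<ge> 2" using mult_mono[OF k n(2)] k by (simp add: M_def)
    have m: "0 < m" "m \<le> 1" using M by (auto simp: m_def)
    have T: "?T 0 1 = - 1 / 2 + (D * Q - R) * m" "?T 1 1 = m + (D\<^sup>2 + 1) * m\<^sup>2"
      "?T 0 2 = - m - Q * m\<^sup>2" "?T 1 2 = - m\<^sup>2 - D * m^3" "?T 2 2 = 4 * m^3 + m^4"
      unfolding card_kernel_values[OF order_less_le_trans[OF zero_less_numeral M]]
      by (simp_all add: m_def power_one_over)
    have m3: "m^3 \<le> m\<^sup>2" "m^4 \<le> m^3" "m\<^sup>2 \<le> m" "0 \<le> m^3" "0 \<le> m\<^sup>2"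
      using m power_decreasing[of 2 3 m] power_decreasing[of 3 4 m] power_decreasing[of 1 2 m] by simp_all
    have nM: "1 / n \<le> 2 * k * m" "1 / n = k / (M - 1)"
      using n k M by (simp_all add: m_def M_def field_simps)
    have nonneg: "\<beta> \<ge> 0" "\<eta> \<ge> 0" using \<gamma> E m by (simp_all add: \<beta>_def \<eta>_def)
    have one: "2 * ?T 0 1 + ?T 1 1 \<le> - 1"
    proof -
      have "2 * ?T 0 1 + ?T 1 1 + 1 = - (1 + 2 * D\<^sup>2) * m + (D\<^sup>2 + 1) * m\<^sup>2"
        unfolding T by (simp add: R_def algebra_simps)
      also have "\<dots> \<le> - (1 + 2 * D\<^sup>2) * m + (D\<^sup>2 + 1) * m"
        using m3 by (intro add_left_mono mult_left_mono) auto
      also have "\<dots> = - (D\<^sup>2 * m)" by (simp add: algebra_simps)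
      also have "\<dots> \<le> 0" using m by simp
      finally show ?thesis by simp
    qed
    have two: "2 * ?T 0 2 + 2 * ?T 1 1 + 4 * ?T 1 2 + ?T 2 2 + 4 * \<alpha>\<^sup>2 * \<beta> + 96 * \<eta> \<le> 0"
    proof -
      have D0: "D \<ge> 0" using \<gamma> k E by (simp add: D_def)
      have "4 * \<alpha>\<^sup>2 * \<beta> = 2 / \<gamma> * m\<^sup>2" using a by (simp add: \<beta>_def)
      then have "2 * ?T 0 2 + 2 * ?T 1 1 + 4 * ?T 1 2 + ?T 2 2 + 4 * \<alpha>\<^sup>2 * \<beta> + 96 * \<eta>
          = (2 * (D\<^sup>2 + 1) - 2 * Q - 4 + 2 / \<gamma>) * m\<^sup>2 + (4 * m^3 + m^4) + 96 * E * m^3 - 4 * D * m^3"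
        unfolding T \<eta>_def by (simp add: algebra_simps)
      also have "\<dots> \<le> (2 * (D\<^sup>2 + 1) - 2 * Q - 4 + 2 / \<gamma>) * m\<^sup>2 + 5 * m\<^sup>2 + 96 * E * m\<^sup>2"
      proof -
        have "4 * m^3 + m^4 \<le> 5 * m\<^sup>2" using m3 by linarith
        moreover have "96 * E * m^3 \<le> 96 * E * m\<^sup>2" using m3 E by (intro mult_left_mono) auto
        moreover have "0 \<le> 4 * D * m^3" using D0 m by simp
        ultimately show ?thesis by linarith
      qed
      also have "\<dots> = - 5 * m\<^sup>2" by (simp add: Q_def algebra_simps)
      also have "\<dots> \<le> 0" by simp
      finally show ?thesis .
    qed
    have three: "?T 1 2 + ?T 2 2 + \<beta> * (2 * \<alpha>\<^sup>2 * (\<alpha> * (1 - \<alpha>) * (1 - \<alpha>\<^sup>2) + 20 / n)) + 36 * \<eta> \<le> 0"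
    proof -
      have "\<beta> * (2 * \<alpha>\<^sup>2 * (\<alpha> * (1 - \<alpha>) * (1 - \<alpha>\<^sup>2) + 20 / n)) = m\<^sup>2 + m\<^sup>2 * (20 / \<gamma>) * (1 / n)"
        unfolding \<gamma>_def[symmetric] using a \<gamma> by (simp add: \<beta>_def field_simps)
      also have "\<dots> \<le> m\<^sup>2 + m\<^sup>2 * (20 / \<gamma>) * (2 * k * m)"
        using nM \<gamma> by (intro add_left_mono mult_left_mono) auto
      also have "\<dots> = m\<^sup>2 + (40 * k / \<gamma>) * m^3" by (simp add: power2_eq_square power3_eq_cube)
      finally have "?T 1 2 + ?T 2 2 + \<beta> * (2 * \<alpha>\<^sup>2 * (\<alpha> * (1 - \<alpha>) * (1 - \<alpha>\<^sup>2) + 20 / n)) + 36 * \<eta>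
          \<le> (- m\<^sup>2 - D * m^3) + (4 * m^3 + m^4) + (m\<^sup>2 + (40 * k / \<gamma>) * m^3) + 36 * (E * m^3)"
        unfolding T \<eta>_def by linarith
      also have "\<dots> = m^4 - m^3" by (simp add: D_def algebra_simps)
      also have "\<dots> \<le> 0" using m3 by simp
      finally show ?thesis .
    qed
    \<comment> \<open>At leading order this is the condition that ties \<open>M\<close> to \<open>n\<close> and forces the slope \<open>k\<close>.\<close>
    have four: "6 * ?T 2 2 \<le> 96 * \<beta> * \<alpha>^4 * (1 - \<alpha>)\<^sup>2 / n"
    proof -
      have "96 * \<beta> * \<alpha>^4 * (1 - \<alpha>)\<^sup>2 / n = 48 * m\<^sup>2 * (\<alpha>\<^sup>2 * (1 - \<alpha>)\<^sup>2 / \<gamma>) * (1 / n)"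
        using a by (simp add: \<beta>_def power2_eq_square power4_eq_xxxx)
      also have "\<dots> = 48 * m\<^sup>2 * (\<alpha>\<^sup>2 * (1 - \<alpha>)\<^sup>2 * k / \<gamma>) / (M - 1)"
        unfolding nM(2) by simp
      also have "\<dots> = 24 * m\<^sup>2 / (M - 1)"
        unfolding k\<gamma> by simp
      finally have "96 * \<beta> * \<alpha>^4 * (1 - \<alpha>)\<^sup>2 / n = 24 / (M\<^sup>2 * (M - 1))"
        by (simp add: m_def power_one_over)
      moreover have "6 * ?T 2 2 = 6 * (4 * M + 1) / M^4"
        unfolding T using M by (simp add: m_def power_one_over field_simps power3_eq_cube power4_eq_xxxx)
      moreover have "6 * (4 * M + 1) / M^4 \<le> 24 / (M\<^sup>2 * (M - 1))"
      proof -
        have "(4 * M + 1) * (M - 1) \<le> 4 * M\<^sup>2" using M by (simp add: power2_eq_square algebra_simps)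
        then have "(4 * M + 1) / M\<^sup>2 \<le> 4 / (M - 1)" using M by (simp add: field_simps)
        then have "6 / M\<^sup>2 * ((4 * M + 1) / M\<^sup>2) \<le> 6 / M\<^sup>2 * (4 / (M - 1))"
          by (intro mult_left_mono) auto
        then show ?thesis by (simp add: power2_eq_square power4_eq_xxxx mult.assoc)
      qed
      ultimately show ?thesis by simp
    qed
    have four': "6 * ?T 2 2 + 32 * \<beta> * \<alpha>^4 / n \<le> 768 * \<eta> * \<alpha>^4"
    proof -
      have "32 * \<beta> * \<alpha>^4 / n = m\<^sup>2 * (16 * \<alpha>\<^sup>2 / \<gamma>) * (1 / n)"
        using a by (simp add: \<beta>_def power2_eq_square power4_eq_xxxx)
      also have "\<dots> \<le> m\<^sup>2 * (16 * \<alpha>\<^sup>2 / \<gamma>) * (2 * k * m)"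
        using nM \<gamma> by (intro mult_left_mono) auto
      also have "\<dots> = (32 * \<alpha>\<^sup>2 * k / \<gamma>) * m^3" by (simp add: power2_eq_square power3_eq_cube)
      finally have *: "32 * \<beta> * \<alpha>^4 / n \<le> (32 * \<alpha>\<^sup>2 * k / \<gamma>) * m^3" .
      have "6 * ?T 2 2 \<le> 30 * m^3"
        unfolding T using m3(2) by argo
      from add_mono[OF this *]
      have "6 * ?T 2 2 + 32 * \<beta> * \<alpha>^4 / n \<le> 30 * m^3 + (32 * \<alpha>\<^sup>2 * k / \<gamma>) * m^3" .
      also have "\<dots> = E * (768 * \<alpha>^4) * m^3"
        unfolding E\<alpha> by (rule distrib_right[symmetric])
      also have "\<dots> = 768 * \<eta> * \<alpha>^4" by (simp add: \<eta>_def)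
      finally show ?thesis .
    qed
    have "mixed_kernel n ?T \<beta> \<eta> \<in> las_feasible \<alpha> 2 n"
      by (intro las_feasible_mixed_kernel assms n nonneg card_kernel_commute positive_kernel_card_kernel
          one two three four four') (use a M in auto)
    then have "las \<alpha> 2 n \<le> ereal (mixed_kernel n ?T \<beta> \<eta> {} {})"
      unfolding las_def by (rule INF_lower)
    also have "mixed_kernel n ?T \<beta> \<eta> {} {} = 1 + Q\<^sup>2 + R\<^sup>2 + k * real n"
      using M by (simp add: mixed_kernel_small card_kernel_values M_def)
    finally show ?thesis .
  qed
  then show ?thesis unfolding k_def by blast
qed


end
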